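(* Let $G=(V,E,\Gamma)$ be a finite connected simple weighted graph with nonzero edge weights $\gamma_e$, such that for every edge $e$ there is a spanning tree of $G$ not containing $e$. Let $\mathcal{I}=\{I_e\}_{e\in E}$ be sets of real numbers such that $\sin$ restricted to each $I_e$ is injective, and let $v_1,\dots,v_c$ be a cycle basis of $G$. Let $r_e>0$ for $e\in E$, and let $(G_M)_{M\ge1}$ be a sequence of graphs such that $G_M$ is obtained from $G$ by replacing each edge $e$ by a path of edges of length $r_eM+o(M)$ as $M\to\infty$; each new edge $e'$ in the path replacing $e$ is given $I_{e'}=I_e$ and weight $\gamma_{e'}=\gamma_e$. Let $W_M$ and $A_M$ be the function and the set associated with $G_M$ as in the context, and let $D_r$ be the diagonal matrix with entries $r_e$. Then $$\lim_{M\to\infty}\frac{\#(W_M(A_M)\cap\mathbb{Z}^c)}{M^c}=|W_r(A_0)|,$$ where $$W_r(\alpha)=\frac1{2\pi}\left(\langle v_1,D_r\sin_\mathcal{I}^{-1}L_0(\alpha)\rangle,\dots,\langle v_c,D_r\sin_\mathcal{I}^{-1}L_0(\alpha)\rangle\right),$$ $L_0$ and $A_0$ are the function $L$ and set $A$ associated with $G$, and $|\cdot|$ denotes $c$-dimensional volume. In particular, if $r_e=1$ for all $e$, then the limit equals $|W(A)|$, where $W$ and $A$ are associated with $G$.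
   Context: For a connected weighted graph $H=(V_H,E_H)$ with ordered, oriented edges, nonzero weights $\gamma_e$, sets $I_e\subseteq\mathbb{R}$ on which $\sin$ is injective, and a cycle basis $v_1,\dots,v_c$, the following objects are associated. The incidence matrix $B:\mathbb{R}^{E_H}\to\mathbb{R}^{V_H}$ has $B_{ie}=1$ if $i$ is the head of $e$, $-1$ if $i$ is the tail, $0$ otherwise. The cycle space is the group of integral vectors in $\ker B$; a cycle basis is a $\mathbb{Z}$-basis of it, and $c=|E_H|-|V_H|+1$. $D_\gamma$ is the diagonal matrix with entries $\gamma_e$. $\sin_\mathcal{I}$ is the componentwise sine restricted to $\prod_eI_e$, with inverse $\sin_\mathcal{I}^{-1}$. For $\alpha\in\mathbb{R}^c$, $$L(\alpha)=\sum_{i=1}^c\alpha_iD_\gamma^{-1}v_i,\qquad W(\alpha)=\frac1{2\pi}\left(\langle v_1,\sin_\mathcal{I}^{-1}L(\alpha)\rangle,\dots,\langle v_c,\sin_\mathcal{I}^{-1}L(\alpha)\rangle\right),$$ and $A\subseteq\mathbb{R}^c$ is the set of $\alpha$ with $L(\alpha)_e\in\sin(I_e)$ for all $e\in E_H$; $W$ is defined on $A$. For $G_M$, the edges in the path replacing $e$ are oriented consistently with $e$, and the cycle basis is the one induced from $v_1,\dots,v_c$: its $i$-th vector has entry $(v_i)_e$ on every edge of the path replacing $e$.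
   Formalization: Each set I_e is additionally assumed bounded with boundary of Lebesgue measure zero (Jordan measurable), since the claim fails for arbitrary sets on which sin is injective (e.g. rational multiples of π in [-π/2, π/2] on a triangle); the degenerate case c = 0 is excluded. *)

theory Defs
  imports
    "HOL-Analysis.Analysis"
    "HOL-Library.Landau_Symbols"
    "Graph_Theory.Digraph_Component"
begin

section \<open>Oriented simple graphs\<close>

text \<open>
  A graph with oriented edges is a \<^typ>\<open>('v, 'e) pre_digraph\<close>. The orientation is bookkeeping
  only: connectedness, cycles and trees refer to the underlying undirected graph. Simplicity
  therefore excludes antiparallel edges as well as parallel ones.
\<close>

definition simple_oriented :: "('v, 'e) pre_digraph \<Rightarrow> bool" where
  "simple_oriented G \<longleftrightarrow>
     fin_digraph G \<and> loopfree_digraph G \<and> inj_on (\<lambda>e. {tail G e, head G e}) (arcs G)"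

text \<open>
  The library's \<^const>\<open>tree\<close> only forbids directed cycles, so it is too weak for an oriented graph.
  In \<^term>\<open>mk_symmetric T\<close> every edge is a directed cycle of length 2; the cycles of a simple
  undirected graph are those of length at least 3.
\<close>

definition undirected_acyclic :: "('v, 'e) pre_digraph \<Rightarrow> bool" where
  "undirected_acyclic T \<longleftrightarrow>
     \<not> (\<exists>p. pre_digraph.cycle (with_proj (mk_symmetric T)) p \<and> 3 \<le> length p)"

definition undirected_spanning_tree :: "('v, 'e) pre_digraph \<Rightarrow> ('v, 'e) pre_digraph \<Rightarrow> bool" where
  "undirected_spanning_tree T G \<longleftrightarrow>
     spanning T G \<and> Digraph_Component.connected T \<and> undirected_acyclic T"

section \<open>Cycle space\<close>

text \<open>
  Vectors indexed by the edges of \<open>H\<close> are functions on the whole edge type. Elements of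
  the cycle space are required to vanish off \<^term>\<open>arcs H\<close>, so that they are determined by their
  entries on the edges.
\<close>

definition incidence :: "('v, 'e) pre_digraph \<Rightarrow> 'v \<Rightarrow> 'e \<Rightarrow> real" where
  "incidence H i e = (if i = head H e then 1 else if i = tail H e then -1 else 0)"

definition cycle_space :: "('v, 'e) pre_digraph \<Rightarrow> ('e \<Rightarrow> real) set" where
  "cycle_space H =
     {x. (\<forall>e. x e \<in> \<int>) \<and> (\<forall>e. e \<notin> arcs H \<longrightarrow> x e = 0) \<and>
         (\<forall>i\<in>verts H. (\<Sum>e\<in>arcs H. incidence H i e * x e) = 0)}"

text \<open>
  A \<open>\<int>\<close>-basis indexed by a finite type \<open>'c\<close>; such a basis can only exist if \<open>CARD('c)\<close> is the
  rank \<open>c\<close> of the cycle space.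
\<close>

definition cycle_basis :: "('v, 'e) pre_digraph \<Rightarrow> ('c::finite \<Rightarrow> 'e \<Rightarrow> real) \<Rightarrow> bool" where
  "cycle_basis H v \<longleftrightarrow>
     (\<forall>i. v i \<in> cycle_space H) \<and>
     (\<forall>x\<in>cycle_space H. \<exists>!k :: 'c \<Rightarrow> int. x = (\<lambda>e. \<Sum>i\<in>UNIV. of_int (k i) * v i e))"

section \<open>The maps \<open>L\<close> and \<open>W\<close> and the set \<open>A\<close>\<close>

definition edge_inner :: "('v, 'e) pre_digraph \<Rightarrow> ('e \<Rightarrow> real) \<Rightarrow> ('e \<Rightarrow> real) \<Rightarrow> real" where
  "edge_inner H x y = (\<Sum>e\<in>arcs H. x e * y e)"

definition sin_inv :: "('e \<Rightarrow> real set) \<Rightarrow> ('e \<Rightarrow> real) \<Rightarrow> 'e \<Rightarrow> real" where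
  "sin_inv I x = (\<lambda>e. inv_into (I e) sin (x e))"

definition L_map :: "('e \<Rightarrow> real) \<Rightarrow> ('c::finite \<Rightarrow> 'e \<Rightarrow> real) \<Rightarrow> real ^ 'c \<Rightarrow> 'e \<Rightarrow> real" where
  "L_map \<gamma> v \<alpha> = (\<lambda>e. \<Sum>i\<in>UNIV. \<alpha> $ i * (inverse (\<gamma> e) * v i e))"

definition A_set ::
  "('v, 'e) pre_digraph \<Rightarrow> ('e \<Rightarrow> real) \<Rightarrow> ('e \<Rightarrow> real set) \<Rightarrow> ('c::finite \<Rightarrow> 'e \<Rightarrow> real)
     \<Rightarrow> (real ^ 'c) set" where
  "A_set H \<gamma> I v = {\<alpha>. \<forall>e\<in>arcs H. L_map \<gamma> v \<alpha> e \<in> sin ` I e}"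

definition W_map ::
  "('v, 'e) pre_digraph \<Rightarrow> ('e \<Rightarrow> real) \<Rightarrow> ('e \<Rightarrow> real set) \<Rightarrow> ('c::finite \<Rightarrow> 'e \<Rightarrow> real)
     \<Rightarrow> real ^ 'c \<Rightarrow> real ^ 'c" where
  "W_map H \<gamma> I v \<alpha> = (1 / (2 * pi)) *\<^sub>R (\<chi> i. edge_inner H (v i) (sin_inv I (L_map \<gamma> v \<alpha>)))"

definition Wr_map ::
  "('v, 'e) pre_digraph \<Rightarrow> ('e \<Rightarrow> real) \<Rightarrow> ('e \<Rightarrow> real) \<Rightarrow> ('e \<Rightarrow> real set)
     \<Rightarrow> ('c::finite \<Rightarrow> 'e \<Rightarrow> real) \<Rightarrow> real ^ 'c \<Rightarrow> real ^ 'c" where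
  "Wr_map H r \<gamma> I v \<alpha> =
     (1 / (2 * pi)) *\<^sub>R (\<chi> i. edge_inner H (v i) (\<lambda>e. r e * sin_inv I (L_map \<gamma> v \<alpha>) e))"

definition integer_points :: "(real ^ 'c::finite) set" where
  "integer_points = {x. \<forall>i. x $ i \<in> \<int>}"

section \<open>Replacing edges by paths\<close>

text \<open>
  Edge \<open>e\<close> is replaced by a path of length \<open>n e\<close> (meaningful for \<open>n e \<ge> 1\<close>) with edges
  \<open>(e, 0), \<dots>, (e, n e - 1)\<close>, traversed from \<open>tail G e\<close> to \<open>head G e\<close> through the new
  vertices \<open>Inr (e, 1), \<dots>, Inr (e, n e - 1)\<close>.
\<close>

definition path_subdivision ::
  "('e \<Rightarrow> nat) \<Rightarrow> ('v, 'e) pre_digraph \<Rightarrow> ('v + 'e \<times> nat, 'e \<times> nat) pre_digraph" where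
  "path_subdivision n G =
     \<lparr>verts = Inl ` verts G \<union> Inr ` {(e, j). e \<in> arcs G \<and> 1 \<le> j \<and> j < n e},
      arcs = {(e, j). e \<in> arcs G \<and> j < n e},
      tail = (\<lambda>(e, j). if j = 0 then Inl (tail G e) else Inr (e, j)),
      head = (\<lambda>(e, j). if Suc j = n e then Inl (head G e) else Inr (e, Suc j))\<rparr>"

definition induced_basis :: "('e \<Rightarrow> nat) \<Rightarrow> ('c \<Rightarrow> 'e \<Rightarrow> real) \<Rightarrow> 'c \<Rightarrow> 'e \<times> nat \<Rightarrow> real" where
  "induced_basis n v i = (\<lambda>(e, j). if j < n e then v i e else 0)"

section \<open>Regularity of the angle sets\<close>

text \<open>
  Comparing lattice point counts with volumes needs the sets \<open>I e\<close> to have a well-defined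
  (Jordan) length; mere injectivity of the sine on them is not enough. For a triangle with unit
  weights and \<open>I e\<close> the rational multiples of \<open>pi\<close> in \<open>[-pi/2, pi/2]\<close>, replacing each edge by a
  path of length \<open>M\<close> makes the normalised count tend to \<open>3/2\<close>, while the image of \<open>W\<close> is countable.
  Every interval on which the sine is injective is Jordan measurable.
\<close>

definition jordan_measurable :: "real set \<Rightarrow> bool" where
  "jordan_measurable S \<longleftrightarrow> bounded S \<and> negligible (frontier S)"

end

theory Submission
  imports Defs "HOL-Analysis.Kronecker_Approximation_Theorem"
begin

text \<open>
  Subdividing does not change \<open>A\<close>, and \<open>W_M\<close> is the map \<open>W_s\<close> of \<open>G\<close> with \<open>s_e\<close> the length of the
  path replacing \<open>e\<close>. It is linear in \<open>s\<close>, so integer points of \<open>W_M(A)\<close> are points of the grid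
  \<open>\<int>\<^sup>c / M\<close> in \<open>W_s(A)\<close> with \<open>s = n_M / M \<rightarrow> r\<close>. Rounding \<open>y\<close> down to the grid and applying dominated
  convergence to the indicator functions, it suffices that for almost every \<open>y\<close> a neighbourhood of
  \<open>y\<close> is eventually contained in, or eventually disjoint from, \<open>W_s(A)\<close> according to whether \<open>y\<close>
  lies in \<open>W_r(A)\<close>. Off the closure of \<open>W_r(A)\<close> this is uniform convergence. At a regular value it
  follows from Brouwer's theorem, as surjectivity near a point with injective derivative survives
  uniform perturbation. The remaining points of the closure are critical values, null by Sard,
  and images of the boundaries of the finitely many pieces of \<open>A\<close> on which every inverse sine is a
  single arcsine branch; these are null since every edge lies on a cycle, so that no component of \<open>L\<close>
  vanishes identically.
\<close>

section \<open>Critical values and stability of images\<close>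

text \<open>
  The library's \<open>baby_Sard\<close> requires a well-ordered index type; this copy of a finite type provides one.
\<close>

typedef 'a wo_copy = "UNIV :: 'a set" ..

instance wo_copy :: (finite) finite
proof
  have "range (Abs_wo_copy :: 'a \<Rightarrow> 'a wo_copy) = UNIV"
    by (metis Rep_wo_copy_inverse surjI)
  then show "finite (UNIV :: 'a wo_copy set)"
    by (metis finite finite_imageI)
qed

instantiation wo_copy :: (finite) wellorder
begin

definition less_eq_wo_copy :: "'a wo_copy \<Rightarrow> 'a wo_copy \<Rightarrow> bool" where
  "x \<le> y \<longleftrightarrow> to_nat (Rep_wo_copy x) \<le> to_nat (Rep_wo_copy y)"

definition less_wo_copy :: "'a wo_copy \<Rightarrow> 'a wo_copy \<Rightarrow> bool" where
  "x < y \<longleftrightarrow> to_nat (Rep_wo_copy x) < to_nat (Rep_wo_copy y)"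

instance
proof
  fix P :: "'a wo_copy \<Rightarrow> bool" and a
  assume step: "\<And>x. (\<And>y. y < x \<Longrightarrow> P y) \<Longrightarrow> P x"
  show "P a"
    by (induction a rule: measure_induct_rule[where f = "\<lambda>x. to_nat (Rep_wo_copy x)"])
      (auto intro: step simp: less_wo_copy_def)
qed (auto simp: less_eq_wo_copy_def less_wo_copy_def Rep_wo_copy_inject)

end

lemma bij_Rep_wo_copy: "bij Rep_wo_copy"
  by (metis Abs_wo_copy_inverse Rep_wo_copy_inverse UNIV_I bij_betw_byWitness subset_UNIV bij_def injI surjI)

lemma CARD_wo_copy: "CARD('a::finite wo_copy) = CARD('a)"
  using bij_betw_same_card[OF bij_Rep_wo_copy] .

text \<open>Reduction to \<open>baby_Sard\<close>: \<open>f\<close> is conjugated by the coordinate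
  relabellings \<open>p\<close> and \<open>q\<close>. Non-injectivity of the derivative survives the
  conjugation, and a non-injective linear endomorphism has deficient rank.\<close>

lemma Sard_noninjective:
  fixes f :: "real^'n::finite \<Rightarrow> real^'n"
  assumes der: "\<And>x. x \<in> S \<Longrightarrow> (f has_derivative f' x) (at x)"
    and sing: "\<And>x. x \<in> S \<Longrightarrow> \<not> inj (f' x)"
  shows "negligible (f ` S)"
proof -
  define p :: "real^'n \<Rightarrow> real^('n wo_copy)" where "p x = (\<chi> i. x $ Rep_wo_copy i)" for x
  define q :: "real^('n wo_copy) \<Rightarrow> real^'n" where "q x = (\<chi> i. x $ Abs_wo_copy i)" for x
  have qp [simp]: "q (p x) = x" for x by (simp add: p_def q_def Abs_wo_copy_inverse)
  have pq [simp]: "p (q x) = x" for x by (simp add: p_def q_def Rep_wo_copy_inverse)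
  have lin: "linear p" "linear q"
    by (auto intro!: linearI simp: p_def q_def vec_eq_iff)
  define g where "g = p \<circ> f \<circ> q"
  have "negligible (g ` (p ` S))"
  proof (rule baby_Sard)
    fix y assume "y \<in> p ` S"
    then have y: "q y \<in> S" by auto
    have "(g has_derivative (p \<circ> f' (q y) \<circ> q)) (at y)"
      unfolding g_def
      by (intro diff_chain_at der y linear_imp_has_derivative lin)
    then show "(g has_derivative (p \<circ> f' (q y) \<circ> q)) (at y within p ` S)"
      by (rule has_derivative_at_withinI)
    have lin': "linear (f' (q y))" using der[OF y] by (rule has_derivative_linear)
    have "\<not> inj (p \<circ> f' (q y) \<circ> q)"
    proof
      assume inj: "inj (p \<circ> f' (q y) \<circ> q)"
      have "inj (f' (q y))"
      proof (rule injI)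
        fix a b assume "f' (q y) a = f' (q y) b"
        then have "(p \<circ> f' (q y) \<circ> q) (p a) = (p \<circ> f' (q y) \<circ> q) (p b)" by simp
        then have "p a = p b" using inj by (rule injD[rotated])
        then show "a = b" by (metis qp)
      qed
      with sing[OF y] show False by simp
    qed
    moreover have "linear (p \<circ> f' (q y) \<circ> q)"
      by (intro linear_compose lin lin')
    ultimately show "rank (matrix (p \<circ> f' (q y) \<circ> q)) < CARD('n wo_copy)"
      by (simp add: less_rank_noninjective)
  qed simp
  \<comment> \<open>\<open>q\<close> is linear between spaces of equal dimension, so it carries null
    sets to null sets.\<close>
  then have "negligible (q ` (g ` (p ` S)))"
    by (rule negligible_differentiable_image_negligible[rotated])
       (auto simp: CARD_wo_copy intro!: linear_imp_differentiable_on lin)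
  moreover have "q ` (g ` (p ` S)) = f ` S"
    by (auto simp: g_def image_image)
  ultimately show ?thesis by simp
qed

text \<open>The \<open>h n\<close> are merely continuous, so preimages come from Brouwer's theorem:
  after composition with the inverse \<open>g\<close> of the derivative, \<open>h n\<close> is close
  to a translation near \<open>a\<close>.\<close>

lemma uniform_limit_image_contains_ball:
  fixes f :: "'a::euclidean_space \<Rightarrow> 'a"
  assumes d: "0 < d"
    and der: "(f has_derivative f') (at a)" and inj: "inj f'"
    and cont: "\<forall>\<^sub>F n in F. continuous_on (cball a d) (h n)"
    and lim: "uniform_limit (cball a d) h f F"
  shows "\<exists>\<delta>>0. \<forall>\<^sub>F n in F. ball (f a) \<delta> \<subseteq> h n ` cball a d"
proof -
  have lin: "linear f'" using der by (rule has_derivative_linear)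
  obtain g where g: "linear g" "\<And>x. g (f' x) = x" "\<And>x. f' (g x) = x"
    using linear_injective_isomorphism[OF lin inj] by blast
  obtain B where B: "B > 0" "\<And>x. norm (g x) \<le> norm x * B"
    using linear_conv_bounded_linear g(1) bounded_linear.pos_bounded by blast
  obtain \<rho> where \<rho>: "\<rho> > 0"
    "\<And>x. norm (x - a) < \<rho> \<Longrightarrow> norm (f x - f a - f' (x - a)) \<le> 1 / (3 * B) * norm (x - a)"
  proof -
    have "1 / (3 * B) > 0" using B by simp
    with der show ?thesis
      unfolding has_derivative_at_alt using that by blast
  qed
  define e where "e = min (\<rho>/2) d"
  have e: "0 < e" "e < \<rho>" "e \<le> d" using \<rho> d by (auto simp: e_def)
  \<comment> \<open>Three errors occur below: the distance of \<open>y\<close> from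
    \<open>f a\<close>, the linearization error of \<open>f\<close>, and the distance of
    \<open>h n\<close> from \<open>f\<close>. Each is at most \<delta>, hence at most
    \<open>e / 3\<close> after applying \<open>g\<close>.\<close>
  define \<delta> where "\<delta> = e / (3 * B)"
  have \<delta>: "\<delta> > 0" using e B by (simp add: \<delta>_def)
  have "\<forall>\<^sub>F n in F. \<forall>x\<in>cball a d. dist (h n x) (f x) < \<delta>"
    using uniform_limitD[OF lim \<delta>] .
  with cont have "\<forall>\<^sub>F n in F. ball (f a) \<delta> \<subseteq> h n ` cball a d"
  proof eventually_elim
    case (elim n)
    show ?case
    proof
      fix y assume y: "y \<in> ball (f a) \<delta>"
      have "\<exists>x\<in>cball a e. g (h n x) = g y"
      \<comment> \<open>A fixed point of \<open>\<lambda>x. g y + (x - g (h n x))\<close> solves the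
        equation; it exists once this map sends \<open>cball a e\<close> into itself.\<close>
      proof (rule brouwer_surjective_cball[where S = "{g y}"])
        have "continuous_on (cball a e) (h n)"
          using elim(1) e by (auto intro: continuous_on_subset)
        then show "continuous_on (cball a e) (\<lambda>x. g (h n x))"
          by (intro linear_continuous_on_compose[OF _ g(1)])
      next
        fix z x assume "z \<in> {g y}" and x: "x \<in> cball a e"
        then have z: "z = g y" by simp
        have xn: "norm (x - a) \<le> e" using x by (simp add: dist_norm norm_minus_commute)
        have gB: "norm (g v) \<le> e / 3" if "norm v \<le> \<delta>" for v
        proof -
          have "norm (g v) \<le> norm v * B" by (rule B)
          also have "\<dots> \<le> \<delta> * B" using that B by (intro mult_right_mono) auto
          also have "\<dots> = e / 3" using B by (simp add: \<delta>_def)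
          finally show ?thesis .
        qed
        have "norm (f x - f a - f' (x - a)) \<le> 1 / (3 * B) * norm (x - a)"
          using \<rho>(2) xn e by simp
        also have "\<dots> \<le> \<delta>" using xn B by (simp add: \<delta>_def divide_right_mono)
        finally have 1: "norm (g (f x - f a - f' (x - a))) \<le> e / 3" by (rule gB)
        have "norm (y - f a) \<le> \<delta>" using y by (simp add: dist_norm norm_minus_commute)
        then have 2: "norm (g (y - f a)) \<le> e / 3" by (rule gB)
        have "x \<in> cball a d" using x e by auto
        then have "norm (h n x - f x) \<le> \<delta>" using elim(2) by (auto simp: dist_norm intro: less_imp_le)
        then have 3: "norm (g (h n x - f x)) \<le> e / 3" by (rule gB)
        have "z + (x - g (h n x)) - a = g (y - f a) - g (f x - f a - f' (x - a)) - g (h n x - f x)"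
          unfolding z by (simp add: linear_diff[OF g(1)] g(2))
        also have "norm \<dots> \<le> e"
          using 1 2 3 norm_triangle_ineq4[of "g (y - f a)" "g (f x - f a - f' (x - a))"]
            norm_triangle_ineq4[of "g (y - f a) - g (f x - f a - f' (x - a))" "g (h n x - f x)"]
          by linarith
        finally show "z + (x - g (h n x)) \<in> cball a e"
          by (simp add: dist_norm norm_minus_commute)
      qed (use e in auto)
      then obtain x where x: "x \<in> cball a e" "g (h n x) = g y" by blast
      then have "h n x = y" using g(3) by metis
      with x e show "y \<in> h n ` cball a d" by force
    qed
  qed
  with \<delta> show ?thesis by blast
qed

section \<open>Counting lattice points\<close>

lemma finite_bounded_integer_points:
  assumes "bounded (B :: (real^'c::finite) set)"
  shows "finite (B \<inter> integer_points)"
proof -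
  obtain R where R: "\<And>x. x \<in> B \<Longrightarrow> norm x \<le> R"
    using assms by (auto simp: bounded_iff)
  define m where "m = \<lceil>R\<rceil>"
  have "B \<inter> integer_points \<subseteq> (\<lambda>k. \<chi> i. real_of_int (k i)) ` (UNIV \<rightarrow>\<^sub>E {-m..m})"
  proof
    fix x assume x: "x \<in> B \<inter> integer_points"
    have int: "real_of_int \<lfloor>x $ i\<rfloor> = x $ i" for i
      using x by (auto simp: integer_points_def Ints_def)
    have "\<bar>x $ i\<bar> \<le> R" for i
      using R[of x] x component_le_norm_cart[of x i] by auto
    then have "\<lfloor>x $ i\<rfloor> \<in> {-m..m}" for i
      using int[of i] le_of_int_ceiling[of R] unfolding m_def atLeastAtMost_iff
      by (smt (verit) of_int_minus of_int_le_iff)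
    then show "x \<in> (\<lambda>k. \<chi> i. real_of_int (k i)) ` (UNIV \<rightarrow>\<^sub>E {-m..m})"
      by (intro image_eqI[where x = "\<lambda>i. \<lfloor>x $ i\<rfloor>"]) (auto simp: int vec_eq_iff)
  qed
  moreover have "finite ((UNIV :: 'c set) \<rightarrow>\<^sub>E {-m..m})"
    by (intro finite_PiE) auto
  ultimately show ?thesis
    using finite_surj by blast
qed

text \<open>The cell is a half-open cube of side \<open>1 / M\<close>. It differs from the closed
  cube only inside the frontier, which is null.\<close>

lemma grid_cell:
  fixes z :: "real^'c::finite"
  assumes M: "0 < (M :: real)" and z: "z \<in> integer_points"
  defines "B \<equiv> {y. (\<chi> i. real_of_int \<lfloor>M * y $ i\<rfloor>) = z}"
  shows "B \<in> lmeasurable" "measure lebesgue B = 1 / M ^ CARD('c)"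
proof -
  define a b where "a = (1/M) *\<^sub>R z" and "b = (\<chi> i. (z $ i + 1) / M)"
  have zi: "\<exists>k. z $ i = real_of_int k" for i
    using z by (auto simp: integer_points_def Ints_def)
  have B: "y \<in> B \<longleftrightarrow> (\<forall>i. z $ i \<le> M * y $ i \<and> M * y $ i < z $ i + 1)" for y
  proof -
    have "real_of_int \<lfloor>M * y $ i\<rfloor> = z $ i \<longleftrightarrow> z $ i \<le> M * y $ i \<and> M * y $ i < z $ i + 1" for i
      using zi[of i] by (auto simp: floor_eq_iff)
    then show ?thesis by (simp add: B_def vec_eq_iff)
  qed
  have sub: "box a b \<subseteq> B" "B \<subseteq> cbox a b"
    by (rule subsetI, simp add: B mem_box_cart a_def b_def field_simps M less_imp_le)+
  have sd: "negligible (sym_diff B (cbox a b))"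
    by (rule negligible_subset[OF negligible_frontier_interval]) (use sub in auto)
  then have "B \<in> lmeasurable \<and> measure lebesgue B = measure lebesgue (cbox a b)"
    using lmeasurable_negligible_symdiff[of "cbox a b" B] measure_negligible_symdiff[of "cbox a b" B]
    by (simp add: Un_commute)
  moreover have "measure lebesgue (cbox a b) = 1 / M ^ CARD('c)"
  proof -
    have "measure lebesgue (cbox a b) = (\<Prod>i\<in>UNIV. b $ i - a $ i)"
      using M by (subst content_cbox_cart[symmetric]) (auto simp: interval_eq_empty_cart a_def b_def divide_less_cancel)
    also have "\<dots> = (\<Prod>i\<in>(UNIV::'c set). 1 / M)"
      by (intro prod.cong) (auto simp: a_def b_def add_divide_distrib)
    finally show ?thesis by (simp add: power_divide)
  qed
  ultimately show "B \<in> lmeasurable" "measure lebesgue B = 1 / M ^ CARD('c)" by auto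
qed

text \<open>Rounding down to the grid turns the normalised count into the measure of a union
  \<open>Q M\<close> of cells. The two local hypotheses make the indicators of \<open>Q M\<close>
  converge off \<open>N\<close>, and the common bound \<open>R\<close> provides a dominating
  function. Measurability of \<open>S\<close> comes out of the limit.\<close>

lemma lattice_count_tendsto_measure:
  fixes X :: "nat \<Rightarrow> (real^'c::finite) set"
  assumes bdd: "\<And>M. X M \<subseteq> cball 0 R"
    and N: "negligible N"
    and outside: "\<And>y. y \<notin> S \<Longrightarrow> y \<notin> N \<Longrightarrow>
      \<exists>\<delta>>0. \<forall>\<^sub>F M in sequentially. ball y \<delta> \<inter> X M = {}"
    and inside: "\<And>y. y \<in> S \<Longrightarrow> y \<notin> N \<Longrightarrow>
      \<exists>\<delta>>0. \<forall>\<^sub>F M in sequentially. ball y \<delta> \<subseteq> X M"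
  shows "S \<in> lmeasurable"
    and "(\<lambda>M. real (card {z \<in> integer_points. (1 / real M) *\<^sub>R z \<in> X M}) / real M ^ CARD('c))
      \<longlonglongrightarrow> measure lebesgue S"
proof -
  let ?c = "CARD('c)"
  define fl :: "nat \<Rightarrow> real^'c \<Rightarrow> real^'c" where "fl M y = (\<chi> i. real_of_int \<lfloor>real M * y $ i\<rfloor>)" for M y
  define h where "h M y = (1 / real M) *\<^sub>R fl M y" for M y
  define P where "P M = {z \<in> integer_points. (1 / real M) *\<^sub>R z \<in> X M}" for M
  \<comment> \<open>For \<open>M = 0\<close> division by zero makes \<open>h M\<close> constantly
    \<open>0\<close>, and the second set could be the whole space.\<close>
  define Q where "Q M = (if M = 0 then {} else {y. h M y \<in> X M})" for M
  have flint: "fl M y \<in> integer_points" for M y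
    by (simp add: fl_def integer_points_def)
  have close: "norm (h M y - y) \<le> real ?c / real M" if "M > 0" for M y
  proof -
    have "\<bar>(h M y - y) $ i\<bar> \<le> 1 / real M" for i
    proof -
      have "(h M y - y) $ i = (real_of_int \<lfloor>real M * y $ i\<rfloor> - real M * y $ i) / real M"
        using that by (simp add: h_def fl_def field_simps)
      moreover have "\<bar>real_of_int \<lfloor>real M * y $ i\<rfloor> - real M * y $ i\<bar> \<le> 1" by linarith
      ultimately show ?thesis by (simp add: abs_divide divide_right_mono)
    qed
    then have "(\<Sum>i\<in>UNIV. \<bar>(h M y - y) $ i\<bar>) \<le> (\<Sum>i\<in>(UNIV::'c set). 1 / real M)"
      by (intro sum_mono) auto
    then show ?thesis using norm_le_l1_cart[of "h M y - y"] by simp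
  qed
  have finP: "finite (P M)" if "M > 0" for M
  proof -
    have "P M \<subseteq> cball 0 (real M * R) \<inter> integer_points"
    proof
      fix z assume z: "z \<in> P M"
      then have "norm ((1 / real M) *\<^sub>R z) \<le> R" using bdd[of M] by (auto simp: P_def)
      then have "norm z \<le> real M * R" using that by (simp add: field_simps)
      then show "z \<in> cball 0 (real M * R) \<inter> integer_points" using z by (simp add: P_def)
    qed
    then show ?thesis
      using finite_bounded_integer_points[of "cball 0 (real M * R)"] finite_subset by blast
  qed
  have QU: "Q M = (\<Union>z\<in>P M. {y. fl M y = z})" if "M > 0" for M
    using that flint by (auto simp: Q_def P_def h_def)
  have Qm: "Q M \<in> lmeasurable" for M
  proof (cases "M = 0")
    case False
    then show ?thesis
      unfolding QU[OF False[unfolded neq0_conv]] fl_def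
      by (intro fmeasurable.finite_UN finP grid_cell(1)) (use False in \<open>auto simp: P_def\<close>)
  qed (simp add: Q_def)
  have Qmeas: "measure lebesgue (Q M) = real (card (P M)) / real M ^ ?c" if "M > 0" for M
  proof -
    have cell: "{y. fl M y = z} \<in> lmeasurable" "measure lebesgue {y. fl M y = z} = 1 / real M ^ ?c"
      if "z \<in> P M" for z
      using grid_cell[of "real M" z] that \<open>M > 0\<close> by (auto simp: P_def fl_def)
    have "measure lebesgue (Q M) = (\<Sum>z\<in>P M. measure lebesgue {y. fl M y = z})"
      unfolding QU[OF that]
      by (rule measure_finite_Union) (use finP[OF that] cell fmeasurableD2[OF cell(1)] in \<open>auto simp: disjoint_family_on_def\<close>)
    also have "\<dots> = real (card (P M)) / real M ^ ?c"
      using cell(2) by simp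
    finally show ?thesis .
  qed
  have near: "\<forall>\<^sub>F M in sequentially. M > 0 \<and> h M y \<in> ball y \<delta>" if "\<delta> > 0" for y \<delta>
  proof -
    have "(\<lambda>M. real ?c / real M) \<longlonglongrightarrow> 0"
      by (intro tendsto_divide_0[OF tendsto_const] filterlim_compose[OF filterlim_real_sequentially]
          filterlim_at_top_imp_at_infinity filterlim_real_sequentially)
    then have "\<forall>\<^sub>F M in sequentially. real ?c / real M < \<delta>"
      using that by (auto dest: order_tendstoD(2))
    then show ?thesis using eventually_gt_at_top[of 0]
    proof eventually_elim
      case (elim M)
      then show ?case using close[of M y] by (auto simp: dist_norm norm_minus_commute)
    qed
  qed
  \<comment> \<open>Deleting the null set \<open>N\<close> gives convergence at every point, the
    form in which \<open>dominated_convergence\<close> takes it.\<close>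
  define f where "f M = indicat_real (Q M - N)" for M
  have fint: "(f M has_integral measure lebesgue (Q M)) UNIV" for M
  proof -
    have "negligible (sym_diff (Q M - N) (Q M))"
      by (rule negligible_subset[OF N]) auto
    then have "Q M - N \<in> lmeasurable" "measure lebesgue (Q M - N) = measure lebesgue (Q M)"
      using lmeasurable_negligible_symdiff[OF Qm[of M], of "Q M - N"] measure_negligible_symdiff[of "Q M" "Q M - N"] Qm
      by (auto simp: Un_commute)
    then show ?thesis
      unfolding f_def using lmeasurable_iff_indicator_has_integral by metis
  qed
  \<comment> \<open>Rounding moves a point by at most \<open>real ?c / real M\<close>, hence by at
    most \<open>real ?c\<close>.\<close>
  let ?D = "cball 0 (R + real ?c) :: (real^'c) set"
  have lim: "(\<lambda>M. f M y) \<longlonglongrightarrow> indicat_real (S - N) y" for y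
  proof -
    \<comment> \<open>The rounded point \<open>h M y\<close> eventually enters the ball around
      \<open>y\<close> on which membership in \<open>X M\<close> is decided.\<close>
    have "\<forall>\<^sub>F M in sequentially. f M y = indicat_real (S - N) y"
    proof (cases "y \<in> N")
      case False
      show ?thesis
      proof (cases "y \<in> S")
        case True
        then obtain \<delta> where \<delta>: "\<delta> > 0" "\<forall>\<^sub>F M in sequentially. ball y \<delta> \<subseteq> X M"
          using inside False by blast
        from \<delta>(2) near[OF \<delta>(1), of y] show ?thesis
          by eventually_elim (use True False in \<open>auto simp: f_def Q_def indicator_def\<close>)
      next
        case nS: False
        then obtain \<delta> where \<delta>: "\<delta> > 0" "\<forall>\<^sub>F M in sequentially. ball y \<delta> \<inter> X M = {}"
          using outside False by blast
        from \<delta>(2) near[OF \<delta>(1), of y] show ?thesis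
          by eventually_elim (use nS False in \<open>auto simp: f_def Q_def indicator_def\<close>)
      qed
    qed (simp add: f_def)
    then show ?thesis by (rule tendsto_eventually)
  qed
  have bound: "norm (f M y) \<le> indicat_real ?D y" for M y
  proof (cases "y \<in> Q M")
    case True
    then have M: "M > 0" and "h M y \<in> X M" by (auto simp: Q_def split: if_splits)
    then have "norm (h M y) \<le> R" using bdd[of M] by auto
    moreover have "real ?c / real M \<le> real ?c"
      using M by (simp add: field_simps)
    ultimately have "norm y \<le> R + real ?c"
      using close[OF M, of y] norm_triangle_ineq4[of "h M y" "h M y - y"] by simp
    then show ?thesis by (simp add: f_def indicator_def)
  qed (simp add: f_def indicator_def)
  have Dint: "indicat_real ?D integrable_on UNIV"
    using lmeasurable_iff_has_integral[THEN iffD1, OF lmeasurable_cball]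
    by (rule has_integral_integrable)
  have dc: "indicat_real (S - N) integrable_on UNIV"
    "(\<lambda>M. integral UNIV (f M)) \<longlonglongrightarrow> integral UNIV (indicat_real (S - N))"
    using dominated_convergence[of f UNIV "indicat_real ?D" "indicat_real (S - N)",
        OF has_integral_integrable[OF fint] Dint bound lim]
    by simp_all
  have "S - N \<in> lmeasurable"
    using iffD2[OF lmeasurable_iff_indicator_has_integral integrable_integral[OF dc(1)]] ..
  moreover have "negligible (sym_diff S (S - N))" by (rule negligible_subset[OF N]) auto
  ultimately have S: "S \<in> lmeasurable" "measure lebesgue S = measure lebesgue (S - N)"
    using lmeasurable_negligible_symdiff[of "S - N" S] measure_negligible_symdiff[of "S - N" S]
    by (auto simp: Un_commute)
  then show "S \<in> lmeasurable" by simp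
  have "(\<lambda>M. measure lebesgue (Q M)) \<longlonglongrightarrow> measure lebesgue S"
    using dc(2) S(2) \<open>S - N \<in> lmeasurable\<close>
    by (simp add: integral_unique[OF fint] lmeasure_integral_UNIV)
  moreover have "\<forall>\<^sub>F M in sequentially. measure lebesgue (Q M) = real (card (P M)) / real M ^ ?c"
    using eventually_gt_at_top[of 0] by eventually_elim (simp add: Qmeas)
  ultimately show "(\<lambda>M. real (card {z \<in> integer_points. (1 / real M) *\<^sub>R z \<in> X M}) / real M ^ ?c)
      \<longlonglongrightarrow> measure lebesgue S"
    unfolding P_def[symmetric] by (rule Lim_transform_eventually)
qed

section \<open>Branches of the inverse sine\<close>

text \<open>These intervals of length \<open>pi\<close> cover the line; sine is strictly monotone on
  each, increasing for even \<open>k\<close> and decreasing for odd \<open>k\<close>.\<close>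

definition sin_branch :: "int \<Rightarrow> real set" where
  "sin_branch k = {of_int k * pi - pi/2 .. of_int k * pi + pi/2}"

text \<open>The cosine factor is the sign of the branch: \<open>1\<close> for even \<open>k\<close>
  and \<open>-1\<close> for odd \<open>k\<close>.\<close>

definition arcsin_branch :: "int \<Rightarrow> real \<Rightarrow> real" where
  "arcsin_branch k y = of_int k * pi + arcsin (cos (of_int k * pi) * y)"

lemma cos_int_pi_abs: "\<bar>cos (real_of_int k * pi)\<bar> = 1"
  using sin_zero_abs_cos_one[of "of_int k * pi"] by (simp add: mult.commute[of _ pi])

lemma arcsin_branch_sin:
  assumes "x \<in> sin_branch k"
  shows "arcsin_branch k (sin x) = x"
proof -
  have "cos (of_int k * pi) * sin x = sin (x - of_int k * pi)"
    by (simp add: sin_diff sin_int_times_real mult.commute)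
  then show ?thesis
    using assms by (simp add: arcsin_branch_def sin_branch_def arcsin_sin)
qed

lemma continuous_on_arcsin_branch: "continuous_on {-1..1} (arcsin_branch k)"
proof -
  have "\<bar>cos (real_of_int k * pi) * y\<bar> \<le> 1" if "y \<in> {-1..1}" for y
    using that by (auto simp: abs_mult cos_int_pi_abs)
  then show ?thesis
    unfolding arcsin_branch_def
    by (intro continuous_intros) (auto simp: abs_le_iff)
qed

lemma arcsin_branch_differentiable:
  assumes "\<bar>y\<bar> < 1"
  shows "arcsin_branch k differentiable (at y)"
proof -
  have "\<bar>cos (real_of_int k * pi) * y\<bar> < 1"
    using assms by (simp add: abs_mult cos_int_pi_abs)
  then have "arcsin differentiable (at (cos (real_of_int k * pi) * y))"
    using DERIV_arcsin by (metis real_differentiable_def abs_less_iff minus_less_iff)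
  then have "(arcsin \<circ> (\<lambda>y. cos (real_of_int k * pi) * y)) differentiable (at y)"
    by (intro differentiable_chain_at) auto
  then show ?thesis
    unfolding arcsin_branch_def o_def by (intro differentiable_add) auto
qed

text \<open>\<open>arcsin\<close> agrees with multiplication by \<open>pi/2\<close> at
  \<open>1\<close> and \<open>-1\<close>. This supplies a smooth substitute where the branch itself
  is not differentiable.\<close>

lemma arcsin_branch_endpoint:
  assumes "\<bar>y\<bar> = 1"
  shows "arcsin_branch k y = of_int k * pi + pi/2 * (cos (of_int k * pi) * y)"
proof -
  have "cos (of_int k * pi) * y = 1 \<or> cos (of_int k * pi) * y = -1"
    using assms cos_int_pi_abs[of k] by (auto simp: abs_if split: if_splits)
  then show ?thesis by (auto simp: arcsin_branch_def)
qed

text \<open>Boundedness limits the relevant branches, and hence the pieces of the domain, to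
  finitely many.\<close>

lemma bounded_subset_sin_branches:
  assumes "bounded S"
  shows "\<exists>m::int. S \<subseteq> (\<Union>k\<in>{-m..m}. sin_branch k)"
proof -
  obtain R where R: "\<And>x. x \<in> S \<Longrightarrow> \<bar>x\<bar> \<le> R"
    using assms by (auto simp: bounded_iff)
  define m where "m = \<lceil>\<bar>R\<bar> / pi\<rceil> + 1"
  have "x \<in> (\<Union>k\<in>{-m..m}. sin_branch k)" if "x \<in> S" for x
  proof -
    define k where "k = \<lfloor>x / pi + 1/2\<rfloor>"
    have k: "of_int k \<le> x / pi + 1/2" "x / pi + 1/2 < of_int k + 1"
      unfolding k_def by linarith+
    have "x / pi + 1/2 \<ge> of_int k" by (rule k)
    then have "of_int k * pi \<le> x + pi/2" by (simp add: field_simps)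
    moreover have "x + pi/2 \<le> of_int k * pi + pi"
      using k(2) by (simp add: field_simps)
    ultimately have "x \<in> sin_branch k" by (simp add: sin_branch_def)
    moreover have "\<bar>x / pi\<bar> \<le> \<bar>R\<bar> / pi"
      using R[OF that] by (simp add: abs_divide divide_right_mono)
    then have "\<bar>x / pi\<bar> \<le> of_int (m - 1)"
      unfolding m_def using le_of_int_ceiling order_trans by fastforce
    then have "x / pi \<le> of_int (m - 1)" "- of_int (m - 1) \<le> x / pi"
      by (auto simp only: abs_le_iff)
    with k have "real_of_int k < of_int (m + 1)" "real_of_int (- m) < of_int (k + 1)"
      by simp_all
    then have "k \<in> {-m..m}" by (simp only: of_int_less_iff) simp
    ultimately show ?thesis by blast
  qed
  then show ?thesis by blast
qed

text \<open>By invariance of domain, sine maps the interior part \<open>J\<close> onto an open set.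
  The rest of the closure of \<open>Y\<close> therefore comes from the frontier of \<open>I\<close>
  and the two ends of the branch, a null set whose image under the differentiable sine is null
  again.\<close>

lemma closure_sin_branch:
  fixes k :: int
  assumes I: "jordan_measurable I"
  defines "Y \<equiv> sin ` (I \<inter> sin_branch k)"
  shows "negligible (closure Y - interior Y)" "closure Y \<subseteq> {-1..1}" "interior Y \<subseteq> {-1<..<1}"
proof -
  define N where "N = frontier I \<union> {of_int k * pi - pi/2, of_int k * pi + pi/2}"
  have "compact (closure I \<inter> sin_branch k)"
    using I unfolding jordan_measurable_def sin_branch_def
    by (intro compact_Int) (auto simp: compact_closure)
  then have "closed (sin ` (closure I \<inter> sin_branch k))"
    by (intro compact_imp_closed compact_continuous_image continuous_on_sin continuous_on_id)
  moreover have "Y \<subseteq> sin ` (closure I \<inter> sin_branch k)"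
    unfolding Y_def using closure_subset by auto
  ultimately have cl: "closure Y \<subseteq> sin ` (closure I \<inter> sin_branch k)"
    by (simp add: closure_minimal)
  also have "\<dots> \<subseteq> {-1..1}" by auto
  finally show 1: "closure Y \<subseteq> {-1..1}" .
  have "interior Y \<subseteq> interior {-1..1}"
    using 1 closure_subset by (intro interior_mono) auto
  then show "interior Y \<subseteq> {-1<..<1}" by simp
  define J where "J = interior I \<inter> {of_int k * pi - pi/2 <..< of_int k * pi + pi/2}"
  have sub: "J \<subseteq> I \<inter> sin_branch k"
    using interior_subset unfolding J_def sin_branch_def by fastforce
  have "inj_on sin J"
    by (rule inj_on_inverseI[where g = "arcsin_branch k"]) (use sub arcsin_branch_sin in auto)
  then have "open (sin ` J)"
    by (intro invariance_of_domain continuous_on_sin continuous_on_id) (auto simp: J_def)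
  then have "sin ` J \<subseteq> interior Y"
    unfolding Y_def using sub by (intro interior_maximal) auto
  moreover have "closure I \<inter> sin_branch k \<subseteq> J \<union> N"
    unfolding J_def N_def frontier_def sin_branch_def by auto
  ultimately have "closure Y - interior Y \<subseteq> sin ` N"
    using cl by blast
  moreover have "negligible (sin ` N)"
  proof (rule negligible_differentiable_image_negligible)
    show "negligible N"
      using I by (simp add: N_def jordan_measurable_def negligible_Un)
    show "sin differentiable_on N"
      unfolding differentiable_on_def
      using DERIV_sin real_differentiable_def differentiable_at_withinI by blast
  qed simp
  ultimately show "negligible (closure Y - interior Y)"
    using negligible_subset by blast
qed

section \<open>Null sets: finite unions and preimages under linear functionals\<close>

lemma negligible_UNION_finite:
  assumes "finite K" "\<And>k. k \<in> K \<Longrightarrow> negligible (X k)"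
  shows "negligible (\<Union>k\<in>K. X k)"
  using assms by (auto intro: negligible_Union)

text \<open>
  By translation invariance every translate of the preimage along \<open>w\<close> has the same measure,
  while along each line in direction \<open>w\<close> the preimage is null; Fubini compares the two.
\<close>

lemma negligible_inner_vimage:
  fixes w :: "'a::euclidean_space"
  assumes N: "negligible N" and w: "w \<noteq> 0"
  shows "negligible {x. w \<bullet> x \<in> N}"
proof -
  \<comment> \<open>A Borel null set around \<open>N\<close> makes the preimage Borel, so that the
    double integral below is of a measurable function.\<close>
  obtain N' where N': "N' \<in> null_sets lborel" "N \<subseteq> N'"
    using N unfolding negligible_iff_null_sets null_sets_completion_iff2 by blast
  then have [measurable]: "N' \<in> sets borel" by auto
  define P where "P = {x. w \<bullet> x \<in> N'}"
  have Pm [measurable]: "P \<in> sets borel"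
  proof -
    have "(\<lambda>x. w \<bullet> x) -` N' \<inter> space borel \<in> sets borel" by measurable
    then show ?thesis by (simp add: P_def vimage_def)
  qed
  have ind [measurable]: "(\<lambda>(x, t::real). indicator P (x + t *\<^sub>R w) :: ennreal) \<in> borel_measurable (lborel \<Otimes>\<^sub>M lborel)"
    by measurable
  have line: "(\<integral>\<^sup>+t. indicator P (x + t *\<^sub>R w) \<partial>lborel) = 0" for x
  proof -
    \<comment> \<open>The parameters \<open>t\<close> with \<open>x + t *\<^sub>R w\<close> in
      \<open>P\<close> form an affine copy of \<open>N'\<close>, because
      \<open>w \<bullet> w\<close> is nonzero.\<close>
    have "negligible ((\<lambda>y. (y - w \<bullet> x) / (w \<bullet> w)) ` N')"
      using N' by (intro negligible_differentiable_image_negligible)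
        (auto simp: negligible_iff_null_sets null_sets_completionI divide_inverse intro!: derivative_intros)
    then have "negligible {t. x + t *\<^sub>R w \<in> P}"
      by (rule negligible_subset) (use w in \<open>force simp: P_def inner_add_right image_iff\<close>)
    moreover have "{t. x + t *\<^sub>R w \<in> P} \<in> sets borel"
    proof -
      have "(\<lambda>t. x + t *\<^sub>R w) -` P \<inter> space borel \<in> sets borel" by measurable
      then show ?thesis by (simp add: vimage_def)
    qed
    ultimately have "emeasure lborel {t. x + t *\<^sub>R w \<in> P} = 0"
      using null_setsD1 by (fastforce simp: negligible_iff_null_sets)
    moreover have "(\<integral>\<^sup>+t. indicator P (x + t *\<^sub>R w) \<partial>lborel) = (\<integral>\<^sup>+t. indicator {t. x + t *\<^sub>R w \<in> P} t \<partial>lborel)"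
      by (intro nn_integral_cong) (auto simp: indicator_def)
    ultimately show ?thesis
      using \<open>{t. x + t *\<^sub>R w \<in> P} \<in> sets borel\<close> by simp
  qed
  have slice: "(\<integral>\<^sup>+x. indicator P (x + t *\<^sub>R w) \<partial>lborel) = emeasure lborel P" for t
  proof -
    have "emeasure lborel P = (\<integral>\<^sup>+x. indicator P x \<partial>distr lborel borel (\<lambda>x. t *\<^sub>R w + x))"
      by (simp add: lborel_distr_plus)
    also have "\<dots> = (\<integral>\<^sup>+x. indicator P (t *\<^sub>R w + x) \<partial>lborel)"
      by (intro nn_integral_distr) auto
    finally show ?thesis by (simp add: add.commute)
  qed
  \<comment> \<open>The line has infinite measure, so a constant with integral zero over it is
    zero.\<close>
  have "(\<integral>\<^sup>+(t::real). emeasure lborel P \<partial>lborel) = 0"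
    using lborel_pair.Fubini'[OF ind] by (simp add: line slice)
  then have "emeasure lborel P = 0"
    by (simp add: nn_integral_const split: if_splits)
  then have "P \<in> null_sets lborel" by auto
  then have "negligible P" by (simp add: negligible_iff_null_sets null_sets_completionI)
  then show ?thesis by (rule negligible_subset) (use N' in \<open>auto simp: P_def\<close>)
qed

text \<open>Coordinate form of the problem: \<open>w e\<close> represents the functional giving the
  \<open>e\<close>-component of \<open>L\<close>, and \<open>u e\<close> collects the
  \<open>e\<close>-entries of the basis vectors divided by \<open>2 * pi\<close>. Then
  \<open>sine_dom\<close> is the set \<open>A\<close> and \<open>angle_sum s\<close> is the map
  \<open>W_s\<close>. In the application \<open>w_nonzero\<close> comes from a cycle through
  \<open>e\<close>, and \<open>w_total\<close> from independence of the cycle basis over the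
  reals.\<close>

locale sine_chart =
  fixes E :: "'e set" and w u :: "'e \<Rightarrow> real^'c::finite" and I :: "'e \<Rightarrow> real set"
  assumes finite_E: "finite E"
    and inj_sin: "\<And>e. e \<in> E \<Longrightarrow> inj_on sin (I e)"
    and jordan: "\<And>e. e \<in> E \<Longrightarrow> jordan_measurable (I e)"
    and w_nonzero: "\<And>e. e \<in> E \<Longrightarrow> w e \<noteq> 0"
    and w_total: "\<And>x. (\<And>e. e \<in> E \<Longrightarrow> w e \<bullet> x = 0) \<Longrightarrow> x = 0"
begin

definition sine_dom :: "(real^'c) set" where
  "sine_dom = {x. \<forall>e\<in>E. w e \<bullet> x \<in> sin ` I e}"

definition angle_sum :: "('e \<Rightarrow> real) \<Rightarrow> real^'c \<Rightarrow> real^'c" where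
  "angle_sum s x = (\<Sum>e\<in>E. (s e * inv_into (I e) sin (w e \<bullet> x)) *\<^sub>R u e)"

definition branch_range :: "('e \<Rightarrow> int) \<Rightarrow> 'e \<Rightarrow> real set" where
  "branch_range k e = sin ` (I e \<inter> sin_branch (k e))"

definition branch_dom :: "('e \<Rightarrow> int) \<Rightarrow> (real^'c) set" where
  "branch_dom k = {x. \<forall>e\<in>E. w e \<bullet> x \<in> branch_range k e}"

text \<open>An open part of \<open>branch_dom k\<close> on which all arguments of the arcsines lie
  strictly between \<open>-1\<close> and \<open>1\<close>, so that derivatives exist.\<close>

definition branch_core :: "('e \<Rightarrow> int) \<Rightarrow> (real^'c) set" where
  "branch_core k = {x. \<forall>e\<in>E. w e \<bullet> x \<in> interior (branch_range k e)}"

definition branch_sum :: "('e \<Rightarrow> int) \<Rightarrow> ('e \<Rightarrow> real) \<Rightarrow> real^'c \<Rightarrow> real^'c" where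
  "branch_sum k s x = (\<Sum>e\<in>E. (s e * arcsin_branch (k e) (w e \<bullet> x)) *\<^sub>R u e)"

section \<open>Decomposition of the domain into branch pieces\<close>

lemma branch_dom_subset: "branch_dom k \<subseteq> sine_dom"
  by (auto simp: branch_dom_def sine_dom_def branch_range_def)

lemma branch_core_subset: "branch_core k \<subseteq> branch_dom k"
  by (auto simp: branch_core_def branch_dom_def dest: interior_subset[THEN subsetD])

lemma open_branch_core: "open (branch_core k)"
proof -
  have "branch_core k = (\<Inter>e\<in>E. (\<lambda>x. w e \<bullet> x) -` interior (branch_range k e))"
    by (auto simp: branch_core_def)
  then show ?thesis
    using finite_E by (auto intro!: open_INT open_vimage continuous_intros)
qed

lemma dom_covered:
  obtains K where "finite K" "sine_dom \<subseteq> (\<Union>k\<in>K. branch_dom k)"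
proof -
  have "\<forall>e\<in>E. \<exists>m::int. I e \<subseteq> (\<Union>k\<in>{-m..m}. sin_branch k)"
    using jordan bounded_subset_sin_branches by (auto simp: jordan_measurable_def)
  then obtain m :: "'e \<Rightarrow> int" where m: "\<And>e. e \<in> E \<Longrightarrow> I e \<subseteq> (\<Union>k\<in>{-m e..m e}. sin_branch k)"
    by metis
  have "sine_dom \<subseteq> (\<Union>k\<in>(\<Pi>\<^sub>E e\<in>E. {-m e..m e}). branch_dom k)"
  proof
    fix x assume "x \<in> sine_dom"
    then have "\<forall>e\<in>E. \<exists>k\<in>{-m e..m e}. w e \<bullet> x \<in> sin ` (I e \<inter> sin_branch k)"
      using m unfolding sine_dom_def by blast
    then obtain k where k: "\<And>e. e \<in> E \<Longrightarrow> k e \<in> {-m e..m e} \<and> w e \<bullet> x \<in> sin ` (I e \<inter> sin_branch (k e))"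
      by metis
    then show "x \<in> (\<Union>k\<in>(\<Pi>\<^sub>E e\<in>E. {-m e..m e}). branch_dom k)"
      by (intro UN_I[of "restrict k E"]) (auto simp: branch_dom_def branch_range_def)
  qed
  moreover have "finite (\<Pi>\<^sub>E e\<in>E. {-m e..m e})"
    by (intro finite_PiE finite_E) auto
  ultimately show ?thesis using that by blast
qed

text \<open>Injectivity of sine on \<open>I e\<close> forces the chosen inverse value to be the one
  on the prescribed branch.\<close>

lemma angle_sum_eq_branch_sum:
  assumes "x \<in> branch_dom k"
  shows "angle_sum s x = branch_sum k s x"
  unfolding angle_sum_def branch_sum_def
proof (intro sum.cong refl)
  fix e assume e: "e \<in> E"
  then obtain t where t: "t \<in> I e" "t \<in> sin_branch (k e)" "w e \<bullet> x = sin t"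
    using assms by (auto simp: branch_dom_def branch_range_def)
  then have "inv_into (I e) sin (w e \<bullet> x) = arcsin_branch (k e) (w e \<bullet> x)"
    using inj_sin[OF e] by (simp add: arcsin_branch_sin inv_into_f_f)
  then show "(s e * inv_into (I e) sin (w e \<bullet> x)) *\<^sub>R u e = (s e * arcsin_branch (k e) (w e \<bullet> x)) *\<^sub>R u e"
    by simp
qed

text \<open>By \<open>w_total\<close> the sum of the \<open>\<bar>w e \<bullet> x\<bar>\<close> is a
  norm, so its minimum on the unit sphere is positive.\<close>

lemma bounded_slab: "bounded {x. \<forall>e\<in>E. \<bar>w e \<bullet> x\<bar> \<le> 1}"
proof -
  define q where "q x = (\<Sum>e\<in>E. \<bar>w e \<bullet> x\<bar>)" for x
  have "continuous_on (sphere 0 1) q"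
    unfolding q_def by (intro continuous_intros)
  then obtain a where a: "a \<in> sphere 0 1" "\<And>x. x \<in> sphere 0 1 \<Longrightarrow> q a \<le> q x"
    using continuous_attains_inf[of "sphere 0 1" q] by auto
  have "q a \<noteq> 0"
  proof
    assume "q a = 0"
    then have "\<And>e. e \<in> E \<Longrightarrow> w e \<bullet> a = 0"
      using finite_E by (simp add: q_def sum_nonneg_eq_0_iff)
    then have "a = 0" by (rule w_total)
    with a(1) show False by simp
  qed
  moreover have "q a \<ge> 0" by (simp add: q_def sum_nonneg)
  ultimately have pos: "q a > 0" by simp
  have "norm x \<le> real (card E) / q a" if "\<forall>e\<in>E. \<bar>w e \<bullet> x\<bar> \<le> 1" for x
  proof (cases "x = 0")
    case False
    have "q a \<le> q ((1 / norm x) *\<^sub>R x)" by (rule a(2)) (use False in simp)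
    also have "\<dots> = q x / norm x"
      by (simp add: q_def sum_divide_distrib abs_mult)
    finally have "q a * norm x \<le> q x" using False by (simp add: field_simps)
    also have "\<dots> \<le> (\<Sum>e\<in>E. 1)" unfolding q_def using that by (intro sum_mono) auto
    finally show ?thesis using pos by (simp add: field_simps)
  qed (use pos in simp)
  then show ?thesis by (auto simp: bounded_iff)
qed

lemma closure_branch_dom:
  "closure (branch_dom k) \<subseteq> {x. \<forall>e\<in>E. w e \<bullet> x \<in> closure (branch_range k e)}"
proof (rule closure_minimal)
  show "branch_dom k \<subseteq> {x. \<forall>e\<in>E. w e \<bullet> x \<in> closure (branch_range k e)}"
    using closure_subset by (auto simp: branch_dom_def)
  have "{x. \<forall>e\<in>E. w e \<bullet> x \<in> closure (branch_range k e)} =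
    (\<Inter>e\<in>E. (\<lambda>x. w e \<bullet> x) -` closure (branch_range k e))" by auto
  then show "closed {x. \<forall>e\<in>E. w e \<bullet> x \<in> closure (branch_range k e)}"
    by (auto intro!: closed_INT closed_vimage continuous_intros)
qed

lemma closure_branch_dom_bound:
  assumes "x \<in> closure (branch_dom k)" "e \<in> E"
  shows "w e \<bullet> x \<in> {-1..1}"
proof -
  have "w e \<bullet> x \<in> closure (branch_range k e)"
    using subsetD[OF closure_branch_dom assms(1)] assms(2) by simp
  then show ?thesis
    unfolding branch_range_def by (rule subsetD[OF closure_sin_branch(2)[OF jordan[OF assms(2)]]])
qed

lemma compact_closure_branch_dom: "compact (closure (branch_dom k))"
proof -
  have "closure (branch_dom k) \<subseteq> {x. \<forall>e\<in>E. \<bar>w e \<bullet> x\<bar> \<le> 1}"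
    using closure_branch_dom_bound by (fastforce simp: abs_le_iff)
  then show ?thesis
    using bounded_subset[OF bounded_slab] by (simp add: compact_eq_bounded_closed)
qed

lemma continuous_on_branch_sum: "continuous_on (closure (branch_dom k)) (branch_sum k s)"
proof -
  have "continuous_on (closure (branch_dom k)) (\<lambda>x. arcsin_branch (k e) (w e \<bullet> x))" if "e \<in> E" for e
    using closure_branch_dom_bound that
    by (intro continuous_on_compose2[OF continuous_on_arcsin_branch] continuous_intros) blast
  then show ?thesis
    unfolding branch_sum_def by (intro continuous_intros) auto
qed

section \<open>Differentiability and the null set of exceptional values\<close>

lemma branch_sum_differentiable:
  assumes "x \<in> branch_core k"
  shows "branch_sum k s differentiable (at x)"
proof -
  have "(arcsin_branch (k e) \<circ> (\<lambda>x. w e \<bullet> x)) differentiable (at x)" if "e \<in> E" for e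
  proof (intro differentiable_chain_at arcsin_branch_differentiable)
    have "w e \<bullet> x \<in> {-1<..<1}"
      using assms that closure_sin_branch(3)[OF jordan[OF that], of "k e"]
      unfolding branch_core_def branch_range_def by blast
    then show "\<bar>w e \<bullet> x\<bar> < 1" by auto
  qed (intro bounded_linear_imp_differentiable bounded_linear_inner_right)
  then show ?thesis
    unfolding branch_sum_def o_def
    by (intro differentiable_sum finite_E differentiable_scaleR differentiable_mult) auto
qed

text \<open>
  Where \<open>w e \<bullet> x\<close> is \<open>1\<close> or \<open>-1\<close> the arcsine is not differentiable, but there it agrees with an
  affine function; hence on the set where this happens exactly for the edges in \<open>D\<close> the map agrees
  with a differentiable one.
\<close>

lemma negligible_branch_sum_boundary:
  "negligible (branch_sum k s ` (closure (branch_dom k) - branch_core k))"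
proof -
  define Z where "Z = closure (branch_dom k) - branch_core k"
  have Z: "negligible Z"
  proof (rule negligible_subset)
    show "negligible (\<Union>e\<in>E. {x. w e \<bullet> x \<in> closure (branch_range k e) - interior (branch_range k e)})"
    proof (intro negligible_UNION_finite finite_E negligible_inner_vimage w_nonzero)
      fix e assume "e \<in> E"
      then show "negligible (closure (branch_range k e) - interior (branch_range k e))"
        unfolding branch_range_def by (intro closure_sin_branch jordan)
    qed
    show "Z \<subseteq> (\<Union>e\<in>E. {x. w e \<bullet> x \<in> closure (branch_range k e) - interior (branch_range k e)})"
      using closure_branch_dom[of k] by (auto simp: Z_def branch_core_def)
  qed
  define P where "P D = {x \<in> Z. {e \<in> E. \<bar>w e \<bullet> x\<bar> = 1} = D}" for D
  have "negligible (branch_sum k s ` P D)" for D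
  proof -
    define g where "g e = (if e \<in> D then (\<lambda>y. of_int (k e) * pi + pi/2 * (cos (of_int (k e) * pi) * y))
      else arcsin_branch (k e))" for e
    define G where "G x = (\<Sum>e\<in>E. (s e * g e (w e \<bullet> x)) *\<^sub>R u e)" for x
    have "g e differentiable (at (w e \<bullet> x))" if "e \<in> E" "x \<in> P D" for e x
    proof (cases "e \<in> D")
      case True
      then show ?thesis unfolding g_def by (auto intro!: derivative_intros)
    next
      case False
      have "x \<in> closure (branch_dom k)" using that by (simp add: P_def Z_def)
      then have "\<bar>w e \<bullet> x\<bar> \<le> 1"
        using closure_branch_dom_bound[of x k e] that by auto
      moreover have "\<bar>w e \<bullet> x\<bar> \<noteq> 1" using False that by (auto simp: P_def)
      ultimately show ?thesis
        using False by (simp add: g_def arcsin_branch_differentiable)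
    qed
    then have "(g e \<circ> (\<lambda>x. w e \<bullet> x)) differentiable (at x)" if "e \<in> E" "x \<in> P D" for e x
      using that by (intro differentiable_chain_at) (auto intro!: derivative_intros)
    then have "G differentiable (at x)" if "x \<in> P D" for x
      unfolding G_def o_def using that
      by (intro differentiable_sum finite_E differentiable_scaleR differentiable_mult) auto
    then have "G differentiable_on P D"
      by (auto simp: differentiable_on_def differentiable_at_withinI)
    then have "negligible (G ` P D)"
      using Z by (intro negligible_differentiable_image_negligible) (auto simp: P_def intro: negligible_subset)
    moreover have "G x = branch_sum k s x" if "x \<in> P D" for x
      unfolding G_def branch_sum_def
      by (intro sum.cong refl) (use that in \<open>auto simp: g_def P_def arcsin_branch_endpoint\<close>)
    ultimately show ?thesis by (metis (no_types, lifting) image_cong)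
  qed
  then have "negligible (\<Union>D\<in>Pow E. branch_sum k s ` P D)"
    using finite_E by (intro negligible_UNION_finite) auto
  then show ?thesis
    by (rule negligible_subset) (auto simp: P_def Z_def)
qed

definition regular :: "('e \<Rightarrow> int) \<Rightarrow> ('e \<Rightarrow> real) \<Rightarrow> (real^'c) set" where
  "regular k s = {x \<in> branch_core k. \<exists>f'. (branch_sum k s has_derivative f') (at x) \<and> inj f'}"

lemma negligible_critical_values:
  "negligible (branch_sum k s ` (branch_core k - regular k s))"
proof (rule Sard_noninjective)
  fix x assume x: "x \<in> branch_core k - regular k s"
  then show D: "(branch_sum k s has_derivative frechet_derivative (branch_sum k s) (at x)) (at x)"
    using branch_sum_differentiable frechet_derivative_works by blast
  show "\<not> inj (frechet_derivative (branch_sum k s) (at x))"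
    using x D by (auto simp: regular_def)
qed

text \<open>The images of the compact closures of finitely many pieces form a closed set containing
  the image, so they also cover its closure. Each value is then the image of a regular point, of a
  boundary point or of a critical point, and the last two kinds are null.\<close>

lemma negligible_irregular_values:
  "negligible (closure (angle_sum s ` sine_dom) - (\<Union>k. angle_sum s ` regular k s))"
proof -
  obtain K where K: "finite K" "sine_dom \<subseteq> (\<Union>k\<in>K. branch_dom k)"
    using dom_covered .
  let ?B = "\<lambda>k. branch_sum k s"
  have "angle_sum s ` sine_dom \<subseteq> (\<Union>k\<in>K. ?B k ` closure (branch_dom k))"
  proof
    fix y assume "y \<in> angle_sum s ` sine_dom"
    then obtain x where x: "x \<in> sine_dom" "y = angle_sum s x" by blast
    then obtain k where "k \<in> K" "x \<in> branch_dom k" using K by blast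
    then have "x \<in> closure (branch_dom k)" "y = ?B k x"
      using x(2) closure_subset by (auto simp: angle_sum_eq_branch_sum)
    with \<open>k \<in> K\<close> show "y \<in> (\<Union>k\<in>K. ?B k ` closure (branch_dom k))" by blast
  qed
  moreover have "compact (\<Union>k\<in>K. ?B k ` closure (branch_dom k))"
    by (intro compact_UN K compact_continuous_image continuous_on_branch_sum compact_closure_branch_dom)
  ultimately have cl: "closure (angle_sum s ` sine_dom) \<subseteq> (\<Union>k\<in>K. ?B k ` closure (branch_dom k))"
    by (simp add: closure_minimal compact_imp_closed)
  have "?B k ` regular k s = angle_sum s ` regular k s" for k
    using branch_core_subset[of k]
    by (intro image_cong) (auto simp: regular_def angle_sum_eq_branch_sum)
  then have br: "?B k ` closure (branch_dom k) - angle_sum s ` regular k s \<subseteq>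
      ?B k ` (closure (branch_dom k) - branch_core k) \<union> ?B k ` (branch_core k - regular k s)" for k
    by blast
  have "closure (angle_sum s ` sine_dom) - (\<Union>k. angle_sum s ` regular k s) \<subseteq>
    (\<Union>k\<in>K. ?B k ` (closure (branch_dom k) - branch_core k) \<union> ?B k ` (branch_core k - regular k s))"
  proof
    fix y assume y: "y \<in> closure (angle_sum s ` sine_dom) - (\<Union>k. angle_sum s ` regular k s)"
    then have "y \<in> (\<Union>k\<in>K. ?B k ` closure (branch_dom k))"
      by (intro subsetD[OF cl]) (rule DiffD1)
    then obtain k where k: "k \<in> K" "y \<in> ?B k ` closure (branch_dom k)"
      by (rule UN_E)
    moreover have "y \<notin> angle_sum s ` regular k s"
      using UN_I[OF UNIV_I, of y "\<lambda>k. angle_sum s ` regular k s" k] y by (simp only: Diff_iff) argo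
    ultimately show "y \<in> (\<Union>k\<in>K. ?B k ` (closure (branch_dom k) - branch_core k) \<union> ?B k ` (branch_core k - regular k s))"
      by (intro UN_I[OF k(1)] subsetD[OF br] DiffI)
  qed
  then show ?thesis
    by (rule negligible_subset[rotated])
      (intro negligible_UNION_finite K negligible_Un negligible_branch_sum_boundary negligible_critical_values)
qed

section \<open>Dependence on the edge lengths\<close>

lemma angle_bound:
  "\<exists>C. \<forall>s. \<forall>x\<in>sine_dom. norm (angle_sum s x) \<le> (\<Sum>e\<in>E. \<bar>s e\<bar> * C e)"
proof -
  have "\<forall>e\<in>E. \<exists>c. \<forall>t\<in>I e. \<bar>t\<bar> \<le> c"
    using jordan by (simp add: jordan_measurable_def bounded_iff)
  then obtain c where c: "\<And>e t. e \<in> E \<Longrightarrow> t \<in> I e \<Longrightarrow> \<bar>t\<bar> \<le> c e"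
    by metis
  show ?thesis
  proof (intro exI[of _ "\<lambda>e. c e * norm (u e)"] allI ballI)
    fix s x assume x: "x \<in> sine_dom"
    have "\<bar>inv_into (I e) sin (w e \<bullet> x)\<bar> \<le> c e" if "e \<in> E" for e
      using x that by (intro c inv_into_into) (auto simp: sine_dom_def)
    then show "norm (angle_sum s x) \<le> (\<Sum>e\<in>E. \<bar>s e\<bar> * (c e * norm (u e)))"
      unfolding angle_sum_def
      by (intro sum_norm_le) (simp add: abs_mult mult_right_mono mult_left_mono mult.assoc)
  qed
qed

text \<open>\<open>angle_sum\<close> is linear in its length parameter, so
  \<open>angle_bound\<close> applied to the difference of the lengths controls the difference of the
  maps uniformly.\<close>

lemma uniform_limit_angle_sum:
  assumes "\<And>e. e \<in> E \<Longrightarrow> ((\<lambda>n. s n e) \<longlongrightarrow> r e) F"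
  shows "uniform_limit sine_dom (\<lambda>n. angle_sum (s n)) (angle_sum r) F"
proof (rule uniform_limitI)
  fix \<epsilon> :: real assume \<epsilon>: "\<epsilon> > 0"
  obtain C where C: "\<And>s x. x \<in> sine_dom \<Longrightarrow> norm (angle_sum s x) \<le> (\<Sum>e\<in>E. \<bar>s e\<bar> * C e)"
    using angle_bound by blast
  have "((\<lambda>n. \<Sum>e\<in>E. \<bar>s n e - r e\<bar> * C e) \<longlongrightarrow> (\<Sum>e\<in>E. \<bar>r e - r e\<bar> * C e)) F"
    by (intro tendsto_intros assms)
  then have "\<forall>\<^sub>F n in F. (\<Sum>e\<in>E. \<bar>s n e - r e\<bar> * C e) < \<epsilon>"
    using \<epsilon> by (auto dest: order_tendstoD(2))
  then show "\<forall>\<^sub>F n in F. \<forall>x\<in>sine_dom. dist (angle_sum (s n) x) (angle_sum r x) < \<epsilon>"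
  proof eventually_elim
    case (elim n)
    show ?case
    proof
      fix x assume "x \<in> sine_dom"
      then have "norm (angle_sum (\<lambda>e. s n e - r e) x) < \<epsilon>"
        using C[of x "\<lambda>e. s n e - r e"] elim by linarith
      moreover have "angle_sum (\<lambda>e. s n e - r e) x = angle_sum (s n) x - angle_sum r x"
        by (simp add: angle_sum_def sum_subtractf left_diff_distrib scaleR_diff_left)
      ultimately show "dist (angle_sum (s n) x) (angle_sum r x) < \<epsilon>"
        by (simp add: dist_norm)
    qed
  qed
qed

text \<open>A small ball around \<open>x\<close> stays inside one piece, where the same branch
  formula is valid for all length parameters at once; there
  \<open>uniform_limit_image_contains_ball\<close> applies.\<close>

lemma regular_value_stable:
  assumes lim: "\<And>e. e \<in> E \<Longrightarrow> ((\<lambda>n. s n e) \<longlongrightarrow> r e) F" and x: "x \<in> regular k r"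
  shows "\<exists>\<delta>>0. \<forall>\<^sub>F n in F. ball (angle_sum r x) \<delta> \<subseteq> angle_sum (s n) ` sine_dom"
proof -
  obtain f' where x': "x \<in> branch_core k" and f': "(branch_sum k r has_derivative f') (at x)" "inj f'"
    using x by (auto simp: regular_def)
  obtain d where d: "d > 0" "cball x d \<subseteq> branch_core k"
    using open_branch_core x' open_contains_cball by blast
  have sub: "cball x d \<subseteq> branch_dom k" using d branch_core_subset by blast
  have eq: "angle_sum s y = branch_sum k s y" if "y \<in> cball x d" for s y
    using that sub by (auto simp: angle_sum_eq_branch_sum)
  have "uniform_limit (cball x d) (\<lambda>n. angle_sum (s n)) (angle_sum r) F"
    using sub branch_dom_subset by (intro uniform_limit_on_subset[OF uniform_limit_angle_sum[OF lim]]) auto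
  then have lim': "uniform_limit (cball x d) (\<lambda>n. branch_sum k (s n)) (branch_sum k r) F"
    by (rule uniform_limit_cong[THEN iffD1, rotated -1]) (auto simp: eq)
  have "continuous_on (cball x d) (branch_sum k (s n))" for n
    using sub closure_subset by (intro continuous_on_subset[OF continuous_on_branch_sum]) auto
  then obtain \<delta> where \<delta>: "\<delta> > 0"
    "\<forall>\<^sub>F n in F. ball (branch_sum k r x) \<delta> \<subseteq> branch_sum k (s n) ` cball x d"
    using uniform_limit_image_contains_ball[OF d(1) f' always_eventually lim'] by blast
  have "branch_sum k (s n) ` cball x d = angle_sum (s n) ` cball x d" for n
    using eq by (intro image_cong) auto
  then have "branch_sum k (s n) ` cball x d \<subseteq> angle_sum (s n) ` sine_dom" for n
    using sub branch_dom_subset by (simp add: image_mono order_trans)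
  note sub' = this
  have "angle_sum r x = branch_sum k r x" using eq[of x] d by simp
  then have "\<forall>\<^sub>F n in F. ball (angle_sum r x) \<delta> \<subseteq> angle_sum (s n) ` sine_dom"
    using eventually_mono[OF \<delta>(2)] order_trans[OF _ sub'] by simp
  with \<delta>(1) show ?thesis by blast
qed

text \<open>\<open>card\<close> is \<open>0\<close> on infinite sets; finiteness makes the counts
  genuine.\<close>

lemma finite_lattice_points: "finite (angle_sum s ` sine_dom \<inter> integer_points)"
proof -
  obtain C where "\<And>s x. x \<in> sine_dom \<Longrightarrow> norm (angle_sum s x) \<le> (\<Sum>e\<in>E. \<bar>s e\<bar> * C e)"
    using angle_bound by blast
  then have "bounded (angle_sum s ` sine_dom)" by (auto simp: bounded_iff)
  then show ?thesis by (rule finite_bounded_integer_points)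
qed

theorem lattice_count_limit:
  assumes lim: "\<And>e. e \<in> E \<Longrightarrow> (\<lambda>M. t M e / real M) \<longlonglongrightarrow> r e"
  shows "angle_sum r ` sine_dom \<in> lmeasurable"
    and "(\<lambda>M. real (card (angle_sum (t M) ` sine_dom \<inter> integer_points)) / real M ^ CARD('c))
      \<longlonglongrightarrow> measure lebesgue (angle_sum r ` sine_dom)"
proof -
  define s where "s M e = t M e / real M" for M e
  have lim': "(\<lambda>M. s M e) \<longlonglongrightarrow> r e" if "e \<in> E" for e
    using lim[OF that] by (simp add: s_def)
  define X where "X M = angle_sum (s M) ` sine_dom" for M
  define S where "S = angle_sum r ` sine_dom"
  \<comment> \<open>Off \<open>N\<close> a point is either outside \<open>closure S\<close> or the
    image of a regular point, and both situations are stable under perturbation of the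
    lengths.\<close>
  define N where "N = closure S - (\<Union>k. angle_sum r ` regular k r)"
  have N: "negligible N"
    unfolding N_def S_def by (rule negligible_irregular_values)
  have reg: "angle_sum r ` regular k r \<subseteq> S" for k
    unfolding S_def regular_def using branch_core_subset branch_dom_subset by blast
  obtain C where C: "\<And>s x. x \<in> sine_dom \<Longrightarrow> norm (angle_sum s x) \<le> (\<Sum>e\<in>E. \<bar>s e\<bar> * C e)"
    using angle_bound by blast
  have "(\<lambda>M. \<Sum>e\<in>E. \<bar>s M e\<bar> * C e) \<longlonglongrightarrow> (\<Sum>e\<in>E. \<bar>r e\<bar> * C e)"
    by (intro tendsto_intros lim')
  then have "Bseq (\<lambda>M. \<Sum>e\<in>E. \<bar>s M e\<bar> * C e)"
    by (intro convergent_imp_Bseq convergentI)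
  then obtain R where R: "\<And>M. norm (\<Sum>e\<in>E. \<bar>s M e\<bar> * C e) \<le> R"
    by (auto simp: Bseq_def)
  have bdd: "X M \<subseteq> cball 0 R" for M
    using C[of _ "s M"] R[of M] by (force simp: X_def)
  have outside: "\<exists>\<delta>>0. \<forall>\<^sub>F M in sequentially. ball y \<delta> \<inter> X M = {}" if "y \<notin> S" "y \<notin> N" for y
  proof -
    have "y \<notin> closure S" using that reg by (auto simp: N_def)
    then obtain \<delta> where \<delta>: "\<delta> > 0" "ball y \<delta> \<inter> S = {}"
      unfolding closure_approachable by (force simp: dist_commute not_less)
    have "\<forall>\<^sub>F M in sequentially. \<forall>x\<in>sine_dom. dist (angle_sum (s M) x) (angle_sum r x) < \<delta>/2"
      using \<delta> by (intro uniform_limitD uniform_limit_angle_sum lim') auto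
    then have "\<forall>\<^sub>F M in sequentially. ball y (\<delta>/2) \<inter> X M = {}"
    proof eventually_elim
      case (elim M)
      have False if x: "x \<in> sine_dom" "dist y (angle_sum (s M) x) < \<delta>/2" for x
      proof -
        have "dist y (angle_sum r x) < \<delta>"
          using elim x dist_triangle_half_r[of "angle_sum (s M) x" y \<delta> "angle_sum r x"]
          by (simp add: dist_commute)
        then show False using \<delta>(2) x(1) by (auto simp: S_def)
      qed
      then show ?case by (auto simp: X_def)
    qed
    with \<delta>(1) show ?thesis by (intro exI[of _ "\<delta>/2"]) auto
  qed
  have inside: "\<exists>\<delta>>0. \<forall>\<^sub>F M in sequentially. ball y \<delta> \<subseteq> X M" if y: "y \<in> S" "y \<notin> N" for y
  proof -
    have "y \<in> closure S" using y closure_subset by blast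
    then obtain k x where x: "x \<in> regular k r" "y = angle_sum r x"
      using y(2) by (auto simp: N_def)
    show ?thesis
      unfolding X_def x(2) by (rule regular_value_stable[OF lim' x(1)])
  qed
  show "angle_sum r ` sine_dom \<in> lmeasurable"
    unfolding S_def[symmetric]
    by (rule lattice_count_tendsto_measure(1)[OF bdd N]) (erule (1) outside inside)+
  have "(\<lambda>M. real (card {z \<in> integer_points. (1 / real M) *\<^sub>R z \<in> X M}) / real M ^ CARD('c))
      \<longlonglongrightarrow> measure lebesgue S"
    by (rule lattice_count_tendsto_measure(2)[OF bdd N]) (erule (1) outside inside)+
  \<comment> \<open>For \<open>M > 0\<close>, linearity in the lengths matches the grid points of
    \<open>X M\<close> with the integer points of the image for \<open>t M\<close>.\<close>
  moreover have "\<forall>\<^sub>F M in sequentially.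
    real (card {z \<in> integer_points. (1 / real M) *\<^sub>R z \<in> X M}) / real M ^ CARD('c) =
    real (card (angle_sum (t M) ` sine_dom \<inter> integer_points)) / real M ^ CARD('c)"
    using eventually_gt_at_top[of 0]
  proof eventually_elim
    case (elim M)
    have scale: "angle_sum (t M) x = real M *\<^sub>R angle_sum (s M) x" for x
      using elim by (simp add: angle_sum_def s_def scaleR_sum_right)
    have eqv: "(1 / real M) *\<^sub>R z = y \<longleftrightarrow> z = real M *\<^sub>R y" for z y :: "real^'c"
      using elim vector_fraction_eq_iff[of 1 "real M" z y] by simp
    have "{z \<in> integer_points. (1 / real M) *\<^sub>R z \<in> X M} =
        angle_sum (t M) ` sine_dom \<inter> integer_points"
      by (intro set_eqI) (simp only: X_def image_iff scale eqv mem_Collect_eq Int_iff conj_commute)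
    then show ?case by (simp only:)
  qed
  ultimately show "(\<lambda>M. real (card (angle_sum (t M) ` sine_dom \<inter> integer_points)) / real M ^ CARD('c))
      \<longlonglongrightarrow> measure lebesgue (angle_sum r ` sine_dom)"
    unfolding S_def by (rule Lim_transform_eventually)
qed

end

section \<open>Cycle bases\<close>

text \<open>Induction along a walk from \<open>a\<close> to \<open>b\<close>: a further step moves
  the sink by adding \<sigma> on its edge, where \<sigma> is \<open>1\<close> or \<open>-1\<close>
  according to the direction in which the oriented edge is traversed.\<close>

lemma unit_flow:
  assumes fin: "finite (arcs T)" and loopfree: "\<And>e. e \<in> arcs T \<Longrightarrow> tail T e \<noteq> head T e"
    and reach: "reachable (with_proj (mk_symmetric T)) a b"
  shows "\<exists>x. (\<forall>e. x e \<in> \<int>) \<and> (\<forall>e. e \<notin> arcs T \<longrightarrow> x e = 0) \<and>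
    (\<forall>i. (\<Sum>e\<in>arcs T. incidence T i e * x e) = of_bool (i = b) - of_bool (i = a))"
  using reach unfolding reachable_def
proof (induction rule: rtrancl_on_induct)
  case base
  show ?case by (rule exI[of _ "\<lambda>_. 0"]) simp
next
  case (step y z)
  then obtain x where x: "\<And>e. x e \<in> \<int>" "\<And>e. e \<notin> arcs T \<Longrightarrow> x e = 0"
    "\<And>i. (\<Sum>e\<in>arcs T. incidence T i e * x e) = of_bool (i = y) - of_bool (i = a)"
    by blast
  from step obtain e where e: "e \<in> arcs T"
    "tail T e = y \<and> head T e = z \<or> head T e = y \<and> tail T e = z"
    by (auto simp: parcs_mk_symmetric)
  define \<sigma> :: real where "\<sigma> = (if head T e = z then 1 else -1)"
  have inc: "incidence T i e * \<sigma> = of_bool (i = z) - of_bool (i = y)" for i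
    using e loopfree[OF e(1)] by (auto simp: incidence_def \<sigma>_def)
  show ?case
  proof (intro exI[of _ "\<lambda>f. x f + (if f = e then \<sigma> else 0)"] conjI allI impI)
    fix f show "x f + (if f = e then \<sigma> else 0) \<in> \<int>" using x(1)[of f] by (auto simp: \<sigma>_def)
  next
    fix f assume "f \<notin> arcs T"
    then show "x f + (if f = e then \<sigma> else 0) = 0" using x(2) e by auto
  next
    fix i
    have "(\<Sum>f\<in>arcs T. incidence T i f * (x f + (if f = e then \<sigma> else 0))) =
        (\<Sum>f\<in>arcs T. incidence T i f * x f) + (\<Sum>f\<in>arcs T. if f = e then incidence T i f * \<sigma> else 0)"
      by (simp add: distrib_left sum.distrib[symmetric] if_distrib cong: if_cong)
    also have "\<dots> = of_bool (i = z) - of_bool (i = a)"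
      using fin e(1) x(3)[of i] inc[of i] by (simp add: sum.delta)
    finally show "(\<Sum>f\<in>arcs T. incidence T i f * (x f + (if f = e then \<sigma> else 0))) =
        of_bool (i = z) - of_bool (i = a)" .
  qed
qed

text \<open>This is the fundamental cycle of \<open>e\<close>: the edge itself together with a unit
  flow in \<open>T\<close> from its head back to its tail.\<close>

lemma cycle_through_edge:
  assumes G: "simple_oriented G" and e: "e \<in> arcs G"
    and T: "undirected_spanning_tree T G" "e \<notin> arcs T"
  shows "\<exists>x\<in>cycle_space G. x e = 1"
proof -
  interpret fin_digraph G using G by (simp add: simple_oriented_def)
  interpret loopfree_digraph G using G by (simp add: simple_oriented_def)
  have sub: "arcs T \<subseteq> arcs G" "verts T = verts G" "tail T = tail G" "head T = head G"
    using T(1) by (auto simp: undirected_spanning_tree_def spanning_def subgraph_def compatible_def)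
  have inc: "incidence T = incidence G"
    using sub by (intro ext) (simp add: incidence_def)
  have "reachable (with_proj (mk_symmetric T)) (head G e) (tail G e)"
    using T(1) e sub(2)
    by (auto simp: undirected_spanning_tree_def Digraph_Component.connected_def strongly_connected_def)
  then obtain x where x: "\<And>f. x f \<in> \<int>" "\<And>f. f \<notin> arcs T \<Longrightarrow> x f = 0"
    "\<And>i. (\<Sum>f\<in>arcs T. incidence T i f * x f) = of_bool (i = tail G e) - of_bool (i = head G e)"
    using unit_flow[of T "head G e" "tail G e"] sub no_loops finite_subset[OF sub(1)] by (metis finite_arcs subsetD)
  define y where "y f = x f + (if f = e then 1 else 0)" for f
  have "y \<in> cycle_space G"
    unfolding cycle_space_def
  proof (intro CollectI conjI allI impI ballI)
    fix f show "y f \<in> \<int>" using x(1)[of f] by (simp add: y_def)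
    show "y f = 0" if "f \<notin> arcs G"
      using that e x(2)[of f] sub(1) by (auto simp: y_def)
  next
    fix i
    have "incidence G i f * y f = incidence G i f * x f + (if f = e then incidence G i f else 0)" for f
      by (simp add: y_def distrib_left)
    then have "(\<Sum>f\<in>arcs G. incidence G i f * y f) =
        (\<Sum>f\<in>arcs G. incidence G i f * x f) + (\<Sum>f\<in>arcs G. if f = e then incidence G i f else 0)"
      by (simp only: sum.distrib)
    also have "(\<Sum>f\<in>arcs G. incidence G i f * x f) = (\<Sum>f\<in>arcs T. incidence T i f * x f)"
      unfolding inc using sub(1) x(2) by (intro sum.mono_neutral_right) auto
    finally show "(\<Sum>f\<in>arcs G. incidence G i f * y f) = 0"
      using x(3)[of i] e no_loops[OF e] by (simp add: sum.delta incidence_def)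
  qed
  moreover have "y e = 1" using x(2)[OF T(2)] by (simp add: y_def)
  ultimately show ?thesis by blast
qed

lemma cycle_basis_entry_nonzero:
  assumes "cycle_basis G v" "x \<in> cycle_space G" "x e \<noteq> 0"
  shows "\<exists>i. v i e \<noteq> 0"
proof (rule ccontr)
  assume "\<nexists>i. v i e \<noteq> 0"
  moreover obtain k where "x = (\<lambda>e. \<Sum>i\<in>UNIV. of_int (k i) * v i e)"
    using assms(1,2) unfolding cycle_basis_def by blast
  ultimately show False using assms(3) by simp
qed

text \<open>
  Simultaneous Dirichlet approximation turns a real linear relation into an integral one: a small
  integral vector vanishes, so the approximating integers do.
\<close>

lemma cycle_basis_real_independent:
  fixes v :: "'c::finite \<Rightarrow> 'e \<Rightarrow> real"
  assumes fin: "finite (arcs G)" and v: "cycle_basis G v"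
    and rel: "\<And>e. e \<in> arcs G \<Longrightarrow> (\<Sum>i\<in>UNIV. a i * v i e) = 0"
  shows "a i = 0"
proof -
  define V where "V = (\<Sum>i\<in>UNIV. \<Sum>e\<in>arcs G. \<bar>v i e\<bar>)"
  obtain b where b: "bij_betw b {..<CARD('c)} (UNIV :: 'c set)"
    using ex_bij_betw_nat_finite[of "UNIV :: 'c set"] by (auto simp: atLeast0LessThan)
  have vG: "v j \<in> cycle_space G" for j using v by (simp add: cycle_basis_def)
  \<comment> \<open>With approximation errors below \<open>1 / N\<close>, each integer
    \<open>y e\<close> on an edge has absolute value at most \<open>V / N < 1\<close> and so
    vanishes.\<close>
  have small: "\<bar>a i\<bar> < 1 / real N" if N: "real N > V" for N
  proof -
    have V0: "V \<ge> 0" by (simp add: V_def sum_nonneg)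
    then have N0: "N > 0" using N by (cases "N = 0") auto
    obtain q p where q: "0 < q" "\<And>j. j < CARD('c) \<Longrightarrow> \<bar>of_int q * a (b j) - of_int (p j)\<bar> < 1 / real N"
      using Dirichlet_approx_simult[OF N0, of "CARD('c)" "a \<circ> b"] by (metis comp_apply)
    define k where "k j = p (the_inv_into {..<CARD('c)} b j)" for j
    have k: "\<bar>of_int q * a j - of_int (k j)\<bar> < 1 / real N" for j
    proof -
      have "j \<in> b ` {..<CARD('c)}" using b by (simp add: bij_betw_def)
      then obtain n where "n < CARD('c)" "j = b n" by auto
      then show ?thesis
        using q(2)[of n] b by (simp add: k_def the_inv_into_f_f bij_betw_def)
    qed
    define y where "y e = (\<Sum>j\<in>UNIV. of_int (k j) * v j e)" for e
    have "y e = 0" for e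
    proof (cases "e \<in> arcs G")
      case True
      have summand: "\<bar>(of_int (k j) - of_int q * a j) * v j e\<bar> \<le> 1 / real N * \<bar>v j e\<bar>" for j
        unfolding abs_mult using k[of j] by (intro mult_right_mono) (auto simp: abs_minus_commute)
      have "y e = (\<Sum>j\<in>UNIV. of_int (k j) * v j e) - of_int q * (\<Sum>j\<in>UNIV. a j * v j e)"
        using rel[OF True] by (simp add: y_def)
      also have "\<dots> = (\<Sum>j\<in>UNIV. (of_int (k j) - of_int q * a j) * v j e)"
        by (simp add: sum_distrib_left sum_subtractf algebra_simps)
      also have "\<bar>\<dots>\<bar> \<le> (\<Sum>j\<in>UNIV. 1 / real N * \<bar>v j e\<bar>)"
        by (intro order_trans[OF sum_abs] sum_mono summand)
      also have "\<dots> \<le> (\<Sum>j\<in>UNIV. 1 / real N * (\<Sum>e\<in>arcs G. \<bar>v j e\<bar>))"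
        using True fin by (intro sum_mono mult_left_mono member_le_sum) auto
      also have "\<dots> = V / real N" by (simp add: V_def sum_divide_distrib)
      also have "\<dots> < 1" using N N0 by simp
      finally have "\<bar>y e\<bar> < 1" .
      moreover have "y e \<in> \<int>"
        unfolding y_def using vG by (intro Ints_sum Ints_mult) (auto simp: cycle_space_def)
      ultimately show ?thesis by (auto elim!: Ints_cases)
    next
      case False
      then show ?thesis using vG by (auto simp: y_def cycle_space_def)
    qed
    then have zero: "(\<lambda>_. 0) = (\<lambda>e. \<Sum>j\<in>UNIV. of_int (k j) * v j e)"
      by (simp add: y_def fun_eq_iff)
    have "(\<lambda>_. 0) \<in> cycle_space G" by (simp add: cycle_space_def)
    then have "\<exists>!k :: 'c \<Rightarrow> int. (\<lambda>_. 0) = (\<lambda>e. \<Sum>j\<in>UNIV. of_int (k j) * v j e)"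
      using v by (simp only: cycle_basis_def)
    then obtain k\<^sub>0 :: "'c \<Rightarrow> int" where unique:
      "\<And>k. (\<lambda>_. 0) = (\<lambda>e. \<Sum>j\<in>UNIV. of_int (k j) * v j e) \<Longrightarrow> k = k\<^sub>0"
      by (elim ex1E) (rule that, blast)
    have "k = k\<^sub>0" by (rule unique[OF zero])
    moreover have "(\<lambda>_. 0) = k\<^sub>0" by (rule unique) simp
    ultimately have "k = (\<lambda>_. 0)" by simp
    \<comment> \<open>With all approximating integers zero, the approximation error is the multiple
      \<open>q * a i\<close> itself, and \<open>q \<ge> 1\<close>.\<close>
    then have "of_int q * \<bar>a i\<bar> < 1 / real N"
      using k[of i] q(1) by (simp add: abs_mult)
    moreover have "1 * \<bar>a i\<bar> \<le> of_int q * \<bar>a i\<bar>"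
      using q(1) by (intro mult_right_mono) auto
    ultimately show ?thesis by simp
  qed
  show ?thesis
  proof (rule ccontr)
    assume "a i \<noteq> 0"
    then have pos: "\<bar>a i\<bar> > 0" by simp
    obtain N :: nat where N: "real N > max V (1 / \<bar>a i\<bar>)" using reals_Archimedean2 by blast
    then have "\<bar>a i\<bar> < 1 / real N" by (intro small) simp
    moreover have N1: "real N > 1 / \<bar>a i\<bar>" using N by simp
    moreover have "real N > 0"
      using pos by (intro less_trans[OF _ N1]) simp
    ultimately show False using pos by (simp add: field_simps)
  qed
qed

section \<open>Subdivided graphs and the assembly of the limit theorem\<close>

lemma sum_arcs_path_subdivision:
  assumes "finite (arcs G)"
  shows "(\<Sum>a\<in>arcs (path_subdivision n G). f a) = (\<Sum>e\<in>arcs G. \<Sum>j<n e. f (e, j))"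
proof -
  have "arcs (path_subdivision n G) = (SIGMA e:arcs G. {..<n e})"
    by (auto simp: path_subdivision_def)
  then show ?thesis using assms by (simp add: sum.Sigma)
qed

theorem theorem3:
  fixes G :: "('v, 'e) pre_digraph"
    and \<gamma> r :: "'e \<Rightarrow> real"
    and I :: "'e \<Rightarrow> real set"
    and v :: "'c::finite \<Rightarrow> 'e \<Rightarrow> real"
    and n :: "nat \<Rightarrow> 'e \<Rightarrow> nat"
  assumes "simple_oriented G"
    and "Digraph_Component.connected G"
    and "\<And>e. e \<in> arcs G \<Longrightarrow> \<gamma> e \<noteq> 0"
    and "\<And>e. e \<in> arcs G \<Longrightarrow> \<exists>T. undirected_spanning_tree T G \<and> e \<notin> arcs T"
    and "\<And>e. e \<in> arcs G \<Longrightarrow> inj_on sin (I e)"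
    and "\<And>e. e \<in> arcs G \<Longrightarrow> jordan_measurable (I e)"
    and "cycle_basis G v"
    and "\<And>e. e \<in> arcs G \<Longrightarrow> r e > 0"
    and "\<And>M e. M \<ge> 1 \<Longrightarrow> e \<in> arcs G \<Longrightarrow> n M e \<ge> 1"
    and "\<And>e. e \<in> arcs G \<Longrightarrow> (\<lambda>M. real (n M e) - r e * real M) \<in> o(\<lambda>M. real M)"
  defines "G_M \<equiv> (\<lambda>M. path_subdivision (n M) G)"
    and "v_M \<equiv> (\<lambda>M. induced_basis (n M) v)"
  defines "A_M \<equiv> (\<lambda>M. A_set (G_M M) (\<gamma> \<circ> fst) (I \<circ> fst) (v_M M))"
    and "W_M \<equiv> (\<lambda>M. W_map (G_M M) (\<gamma> \<circ> fst) (I \<circ> fst) (v_M M))"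
    and "A\<^sub>0 \<equiv> A_set G \<gamma> I v"
  shows "(\<forall>M\<ge>1. finite (W_M M ` A_M M \<inter> integer_points)) \<and>
    Wr_map G r \<gamma> I v ` A\<^sub>0 \<in> lmeasurable \<and>
    (\<lambda>M. real (card (W_M M ` A_M M \<inter> integer_points)) / real M ^ CARD('c))
      \<longlonglongrightarrow> measure lebesgue (Wr_map G r \<gamma> I v ` A\<^sub>0) \<and>
    ((\<forall>e\<in>arcs G. r e = 1) \<longrightarrow>
      (\<lambda>M. real (card (W_M M ` A_M M \<inter> integer_points)) / real M ^ CARD('c))
        \<longlonglongrightarrow> measure lebesgue (W_map G \<gamma> I v ` A\<^sub>0))"
proof -
  define w where "w e = (\<chi> i. inverse (\<gamma> e) * v i e)" for e
  define u where "u e = (1 / (2 * pi)) *\<^sub>R (\<chi> i. v i e)" for e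
  have fin: "finite (arcs G)"
    using assms(1) by (auto simp: simple_oriented_def fin_digraph_def fin_digraph_axioms_def)
  have L: "L_map \<gamma> v \<alpha> e = w e \<bullet> \<alpha>" for \<alpha> e
    by (simp add: L_map_def w_def inner_vec_def mult.commute)
  interpret sine_chart "arcs G" w u I
  proof
    show "finite (arcs G)" by (rule fin)
    fix e assume e: "e \<in> arcs G"
    show "inj_on sin (I e)" "jordan_measurable (I e)" using assms(5,6) e by auto
    \<comment> \<open>A spanning tree avoiding \<open>e\<close> closes up to a cycle through
      \<open>e\<close>, so some basis vector is nonzero there.\<close>
    obtain x where "x \<in> cycle_space G" "x e = 1"
      using cycle_through_edge[OF assms(1) e] assms(4)[OF e] by blast
    then obtain i where "v i e \<noteq> 0"
      using cycle_basis_entry_nonzero[OF assms(7), of x e] by auto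
    then show "w e \<noteq> 0" using assms(3)[OF e] by (auto simp: w_def vec_eq_iff)
  next
    fix \<alpha> assume \<alpha>: "\<And>e. e \<in> arcs G \<Longrightarrow> w e \<bullet> \<alpha> = 0"
    \<comment> \<open>Cancelling the nonzero weight leaves a real linear relation among the basis
      vectors.\<close>
    have "(\<Sum>i\<in>UNIV. \<alpha> $ i * v i e) = 0" if "e \<in> arcs G" for e
    proof -
      have "w e \<bullet> \<alpha> = inverse (\<gamma> e) * (\<Sum>i\<in>UNIV. \<alpha> $ i * v i e)"
        by (simp add: w_def inner_vec_def sum_distrib_left mult_ac)
      then show ?thesis using \<alpha>[OF that] assms(3)[OF that] by simp
    qed
    then show "\<alpha> = 0"
      using cycle_basis_real_independent[OF fin assms(7), of "\<lambda>i. \<alpha> $ i"] by (simp add: vec_eq_iff)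
  qed
  have A0: "A\<^sub>0 = sine_dom"
    by (simp add: A\<^sub>0_def A_set_def sine_dom_def L)
  have Wr: "Wr_map G s \<gamma> I v \<alpha> = angle_sum s \<alpha>" for s \<alpha>
    by (simp add: vec_eq_iff Wr_map_def angle_sum_def edge_inner_def sin_inv_def L u_def
        sum_distrib_left sum_component mult_ac)
  have LM: "L_map (\<gamma> \<circ> fst) (v_M M) \<alpha> (e, j) = w e \<bullet> \<alpha>" if "j < n M e" for M \<alpha> e j
    using that by (simp add: v_M_def induced_basis_def L_map_def w_def inner_vec_def mult.commute)
  have AM: "A_M M = sine_dom" if "M \<ge> 1" for M
  proof -
    have "(\<forall>a\<in>arcs (path_subdivision (n M) G). L_map (\<gamma> \<circ> fst) (v_M M) \<alpha> a \<in> sin ` (I \<circ> fst) a) \<longleftrightarrow>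
        (\<forall>e\<in>arcs G. \<forall>j<n M e. w e \<bullet> \<alpha> \<in> sin ` I e)" for \<alpha>
      by (auto simp: path_subdivision_def LM)
    \<comment> \<open>Each path has at least one edge, so the condition at \<open>e\<close> is not
      lost, and all copies repeat it.\<close>
    moreover have "(\<forall>j<n M e. P) \<longleftrightarrow> P" if "e \<in> arcs G" for e P
      using assms(9)[OF \<open>M \<ge> 1\<close> that] by (auto intro: Suc_le_lessD)
    ultimately show ?thesis
      by (simp add: A_M_def G_M_def A_set_def sine_dom_def)
  qed
  have WM: "W_M M \<alpha> = angle_sum (\<lambda>e. real (n M e)) \<alpha>" for M \<alpha>
  proof -
    \<comment> \<open>The \<open>n M e\<close> copies of \<open>e\<close> contribute equal terms, so
      the path length becomes a factor.\<close>
    have "edge_inner (G_M M) (v_M M i) (sin_inv (I \<circ> fst) (L_map (\<gamma> \<circ> fst) (v_M M) \<alpha>)) =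
        (\<Sum>e\<in>arcs G. v i e * (real (n M e) * inv_into (I e) sin (w e \<bullet> \<alpha>)))" for i
      by (simp add: edge_inner_def G_M_def sum_arcs_path_subdivision[OF fin] sin_inv_def LM)
        (simp add: v_M_def induced_basis_def mult_ac)
    then show ?thesis
      by (simp add: vec_eq_iff W_M_def W_map_def angle_sum_def u_def sum_distrib_left sum_component mult_ac)
  qed
  have lim: "(\<lambda>M. real (n M e) / real M) \<longlonglongrightarrow> r e" if "e \<in> arcs G" for e
  proof -
    have "(\<lambda>M. (real (n M e) - r e * real M) / real M) \<longlonglongrightarrow> 0"
      by (rule smalloD_tendsto[OF assms(10)[OF that]])
    then have "(\<lambda>M. (real (n M e) - r e * real M) / real M + r e) \<longlonglongrightarrow> 0 + r e"
      by (intro tendsto_intros)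
    moreover have "\<forall>\<^sub>F M in sequentially.
        (real (n M e) - r e * real M) / real M + r e = real (n M e) / real M"
      using eventually_gt_at_top[of 0] by eventually_elim (simp add: field_simps)
    ultimately show ?thesis using Lim_transform_eventually by fastforce
  qed
  note count = lattice_count_limit[of "\<lambda>M e. real (n M e)" r, OF lim]
  have image: "W_M M ` A_M M = angle_sum (\<lambda>e. real (n M e)) ` sine_dom" if "M \<ge> 1" for M
    using that by (simp add: AM WM)
  \<comment> \<open>The path lengths are known to be positive for \<open>M \<ge> 1\<close> only, so
    the identification of the images enters as an eventual equality.\<close>
  have "\<forall>\<^sub>F M in sequentially.
      real (card (angle_sum (\<lambda>e. real (n M e)) ` sine_dom \<inter> integer_points)) / real M ^ CARD('c) =
      real (card (W_M M ` A_M M \<inter> integer_points)) / real M ^ CARD('c)"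
    using eventually_ge_at_top[of 1] by eventually_elim (simp add: image)
  from Lim_transform_eventually[OF count(2) this]
  have main: "(\<lambda>M. real (card (W_M M ` A_M M \<inter> integer_points)) / real M ^ CARD('c))
      \<longlonglongrightarrow> measure lebesgue (Wr_map G r \<gamma> I v ` A\<^sub>0)"
    by (simp add: Wr A0)
  moreover have "Wr_map G r \<gamma> I v = W_map G \<gamma> I v" if "\<forall>e\<in>arcs G. r e = 1"
    using that by (intro ext) (simp add: Wr_map_def W_map_def edge_inner_def)
  moreover have "Wr_map G r \<gamma> I v ` A\<^sub>0 \<in> lmeasurable"
    using count(1) by (simp add: Wr A0)
  moreover have "\<forall>M\<ge>1. finite (W_M M ` A_M M \<inter> integer_points)"
    using finite_lattice_points by (simp add: image)
  ultimately show ?thesis by auto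
qed

end
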